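(* Let $\mathcal{A}$ and $\mathcal{B}$ be $AW^*$-algebras, let $\mathcal{I}\subseteq\mathcal{A}$ and $\mathcal{J}\subseteq\mathcal{B}$ be operator intervals, and let $\Phi:\mathcal{I}\to\mathcal{J}$ be an order isomorphism. Then there exists a unique pair of order isomorphisms $\Phi_1:p_{\mathcal{A}}(1)\mathcal{I}\to p_{\mathcal{B}}(1)\mathcal{J}$ and $\Phi_{-1}:p_{\mathcal{A}}(1)^\perp\mathcal{I}\to p_{\mathcal{B}}(1)^\perp\mathcal{J}$ such that $$\Phi(a)=\Phi_1\big(p_{\mathcal{A}}(1)a\big)+\Phi_{-1}\big(p_{\mathcal{A}}(1)^\perp a\big)\qquad\text{for all } a\in\mathcal{I}.$$
   Context: All $C^*$-algebras are unital. For a $C^*$-algebra $\mathcal{A}$, $\mathcal{A}^{sa}$ is the self-adjoint part with order $a\le b\iff b-a$ positive; $a<b$ means $b-a$ is positive and invertible. An $AW^*$-algebra is a $C^*$-algebra $\mathcal{A}$ such that for every nonempty $\mathcal{F}\subseteq\mathcal{A}$ there is a projection $p$ with $\{a\in\mathcal{A}:ba=0\ \forall b\in\mathcal{F}\}=p\mathcal{A}$. An operator interval in $\mathcal{A}$ is either $\mathcal{A}^{sa}$, or one of $\{c\in\mathcal{A}^{sa}:c\ge a\}$, $\{c:c\le a\}$, $\{c:a<c\}$, $\{c:c<a\}$ for some $a\in\mathcal{A}^{sa}$, or one of $\{c:a\le c\le b\}$, $\{c:a\le c<b\}$, $\{c:a<c\le b\}$, $\{c:a<c<b\}$ for some $a,b\in\mathcal{A}^{sa}$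 with $a<b$ (all with $c\in\mathcal{A}^{sa}$), with the induced order. For an $AW^*$-algebra $\mathcal{A}$, $p_{\mathcal{A}}(1)$ denotes the unique central projection such that $p_{\mathcal{A}}(1)\mathcal{A}$ is commutative (possibly $0$) and $p_{\mathcal{A}}(1)^\perp\mathcal{A}$ has no nonzero commutative direct summand (i.e. no nonzero central projection $z\le p_{\mathcal{A}}(1)^\perp$ with $z\mathcal{A}$ commutative); $p^\perp=1-p$. For a set $\mathcal{F}$ and projection $p$, $p\mathcal{F}=\{pa:a\in\mathcal{F}\}$, with the induced order. An order isomorphism is a bijection preserving order in both directions. *)

theory Defs
  imports Complex_Main
begin

class cstar_algebra = real_normed_algebra_1 + banach +
  fixes adj :: "'a \<Rightarrow> 'a"
    and scaleC :: "complex \<Rightarrow> 'a \<Rightarrow> 'a"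
  assumes scaleC_add_right: "scaleC c (x + y) = scaleC c x + scaleC c y"
    and scaleC_add_left: "scaleC (c + d) x = scaleC c x + scaleC d x"
    and scaleC_scaleC: "scaleC c (scaleC d x) = scaleC (c * d) x"
    and scaleC_one: "scaleC 1 x = x"
    and scaleR_scaleC: "scaleR r x = scaleC (complex_of_real r) x"
    and norm_scaleC: "norm (scaleC c x) = cmod c * norm x"
    and mult_scaleC_left: "scaleC c x * y = scaleC c (x * y)"
    and mult_scaleC_right: "x * scaleC c y = scaleC c (x * y)"
    and adj_adj: "adj (adj x) = x"
    and adj_add: "adj (x + y) = adj x + adj y"
    and adj_scaleC: "adj (scaleC c x) = scaleC (cnj c) (adj x)"
    and adj_mult: "adj (x * y) = adj y * adj x"
    and cstar_identity: "norm (adj x * x) = (norm x)\<^sup>2"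

definition invertible_el :: "'a::cstar_algebra \<Rightarrow> bool" where
  "invertible_el a \<longleftrightarrow> (\<exists>c. a * c = 1 \<and> c * a = 1)"

definition spectrum_el :: "'a::cstar_algebra \<Rightarrow> complex set" where
  "spectrum_el a = {z. \<not> invertible_el (a - scaleC z 1)}"

definition self_adjoint :: "'a::cstar_algebra \<Rightarrow> bool" where
  "self_adjoint a \<longleftrightarrow> adj a = a"

definition positive_el :: "'a::cstar_algebra \<Rightarrow> bool" where
  "positive_el a \<longleftrightarrow> self_adjoint a \<and> (\<forall>z\<in>spectrum_el a. Im z = 0 \<and> Re z \<ge> 0)"

definition op_le :: "'a::cstar_algebra \<Rightarrow> 'a \<Rightarrow> bool" where
  "op_le a b \<longleftrightarrow> positive_el (b - a)"

definition op_lt :: "'a::cstar_algebra \<Rightarrow> 'a \<Rightarrow> bool" where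
  "op_lt a b \<longleftrightarrow> positive_el (b - a) \<and> invertible_el (b - a)"

definition sa_part :: "'a::cstar_algebra set" where
  "sa_part = {a. self_adjoint a}"

definition is_projection :: "'a::cstar_algebra \<Rightarrow> bool" where
  "is_projection p \<longleftrightarrow> p * p = p \<and> adj p = p"

definition is_central :: "'a::cstar_algebra \<Rightarrow> bool" where
  "is_central p \<longleftrightarrow> (\<forall>x. p * x = x * p)"

definition left_mult_set :: "'a::cstar_algebra \<Rightarrow> 'a set \<Rightarrow> 'a set" where
  "left_mult_set p F = (\<lambda>a. p * a) ` F"

definition perp :: "'a::cstar_algebra \<Rightarrow> 'a" where
  "perp p = 1 - p"

definition AW_algebra :: "'a::cstar_algebra itself \<Rightarrow> bool" where
  "AW_algebra (_ :: 'a itself) \<longleftrightarrow>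
     (\<forall>F :: 'a set. F \<noteq> {} \<longrightarrow>
        (\<exists>p. is_projection p \<and> {a. \<forall>b\<in>F. b * a = 0} = left_mult_set p UNIV))"

definition commutative_set :: "'a::cstar_algebra set \<Rightarrow> bool" where
  "commutative_set S \<longleftrightarrow> (\<forall>x\<in>S. \<forall>y\<in>S. x * y = y * x)"

definition pA1 :: "'a::cstar_algebra itself \<Rightarrow> 'a" where
  "pA1 (_ :: 'a itself) = (THE p :: 'a. is_projection p \<and> is_central p
       \<and> commutative_set (left_mult_set p UNIV)
       \<and> \<not> (\<exists>z. is_projection z \<and> is_central z \<and> z \<noteq> 0 \<and> op_le z (perp p)
                \<and> commutative_set (left_mult_set z UNIV)))"

definition operator_interval :: "'a::cstar_algebra set \<Rightarrow> bool" where
  "operator_interval I \<longleftrightarrow>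
     I = sa_part
   \<or> (\<exists>a\<in>sa_part.
        I = {c\<in>sa_part. op_le a c} \<or> I = {c\<in>sa_part. op_le c a}
      \<or> I = {c\<in>sa_part. op_lt a c} \<or> I = {c\<in>sa_part. op_lt c a})
   \<or> (\<exists>a\<in>sa_part. \<exists>b\<in>sa_part. op_lt a b \<and>
        (I = {c\<in>sa_part. op_le a c \<and> op_le c b} \<or> I = {c\<in>sa_part. op_le a c \<and> op_lt c b}
       \<or> I = {c\<in>sa_part. op_lt a c \<and> op_le c b} \<or> I = {c\<in>sa_part. op_lt a c \<and> op_lt c b}))"

definition order_iso_on :: "('a::cstar_algebra \<Rightarrow> 'b::cstar_algebra) \<Rightarrow> 'a set \<Rightarrow> 'b set \<Rightarrow> bool" where
  "order_iso_on f S T \<longleftrightarrow> bij_betw f S T \<and>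
     (\<forall>x\<in>S. \<forall>y\<in>S. op_le x y \<longleftrightarrow> op_le (f x) (f y))"

end

theory Submission
  imports Defs
begin

text \<open>The commutative part is recognised by suprema. In \<open>\<A>\<^sup>s\<^sup>a\<close>, two positive elements \<open>a, b\<close> with
  infimum \<open>0\<close> satisfy \<open>a \<A> b = 0\<close>; hence, if \<open>y\<close> and \<open>z\<close> have a supremum, there is a central
  projection \<open>r\<close> with \<open>r y \<le> r z\<close> and \<open>r\<^sup>\<bottom> z \<le> r\<^sup>\<bottom> y\<close>. If \<open>y \<ge> 0\<close> has a supremum with every
  \<open>z \<ge> 0\<close>, comparing it with central elements approximates \<open>y\<close> by central elements, so \<open>y\<close> is central;
  if this holds for all elements of \<open>[0, y]\<close>, then \<open>y\<close> lies in \<open>p \<A>\<close>, where \<open>p = p\<^sub>\<A>(1)\<close> generates the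
  annihilator of all commutators. Conversely, elements of \<open>p \<A>\<close> have suprema with everything.
  For \<open>a \<le> b\<close> in an operator interval this describes \<open>b - a \<in> p \<A>\<close>, hence also
  \<open>b - a \<in> p\<^sup>\<bottom> \<A>\<close>, by the order of the interval alone. An order isomorphism therefore preserves the
  relations \<open>p a = p b\<close> and \<open>p\<^sup>\<bottom> a = p\<^sup>\<bottom> b\<close>, and it splits because operator intervals are closed under
  \<open>(a, b) \<mapsto> p a + p\<^sup>\<bottom> b\<close>.\<close>

section \<open>Positive elements\<close>

lemma adj_0 [simp]: "adj (0::'a::cstar_algebra) = 0"
  using adj_add[of 0 "0::'a"] by simp

lemma adj_minus [simp]: "adj (- x) = - adj (x::'a::cstar_algebra)"
proof -
  have "adj (- x) + adj x = 0" using adj_add[of "-x" x] by simp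
  then show ?thesis by (simp add: eq_neg_iff_add_eq_0)
qed

lemma adj_diff [simp]: "adj (x - y) = adj x - adj (y::'a::cstar_algebra)"
  using adj_add[of x "-y"] by simp

lemma adj_scaleR [simp]: "adj (t *\<^sub>R x) = t *\<^sub>R adj (x::'a::cstar_algebra)"
  by (simp add: scaleR_scaleC adj_scaleC)

lemma adj_1 [simp]: "adj (1::'a::cstar_algebra) = 1"
  by (metis adj_adj adj_mult mult.right_neutral mult.left_neutral)

declare adj_adj [simp] adj_add [simp] adj_mult [simp]

lemma norm_adj [simp]: "norm (adj x) = norm (x::'a::cstar_algebra)"
proof -
  have "norm x \<le> norm (adj x)" for x :: 'a
  proof (cases "x = 0")
    case False
    have "norm x * norm x \<le> norm (adj x) * norm x"
      using cstar_identity[of x] norm_mult_ineq[of "adj x" x] by (simp add: power2_eq_square)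
    then show ?thesis using False by simp
  qed simp
  from this[of x] this[of "adj x"] show ?thesis by simp
qed

lemma tendsto_adj: "(f \<longlongrightarrow> l) F \<Longrightarrow> ((\<lambda>n. adj (f n)) \<longlongrightarrow> adj (l::'a::cstar_algebra)) F"
  by (simp only: tendsto_iff dist_norm norm_adj flip: adj_diff)

lemma norm_self_adjoint_square: "adj x = x \<Longrightarrow> norm (x * x) = (norm (x::'a::cstar_algebra))\<^sup>2"
  using cstar_identity[of x] by simp

lemma adj_mult_self_eq_0: "adj x * x = 0 \<longleftrightarrow> x = (0::'a::cstar_algebra)"
  by (metis cstar_identity mult_zero_right norm_eq_zero zero_eq_power2)

lemma scaleC_i_i [simp]: "scaleC \<i> (scaleC \<i> x) = - (x::'a::cstar_algebra)"
proof -
  have "scaleC \<i> (scaleC \<i> x) = scaleR (-1) x" by (simp only: scaleC_scaleC scaleR_scaleC) simp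
  then show ?thesis by simp
qed

lemma scaleC_minus_left: "scaleC (- c) x = - scaleC c (x::'a::cstar_algebra)"
proof -
  have "scaleC (- c) x = scaleC (-1) (scaleC c x)" by (simp add: scaleC_scaleC)
  also have "\<dots> = scaleR (-1) (scaleC c x)" by (simp only: scaleR_scaleC) simp
  finally show ?thesis by simp
qed

lemma scaleC_minus_right: "scaleC c (- x) = - scaleC c (x::'a::cstar_algebra)"
  by (metis add.right_inverse add_cancel_right_right minus_unique scaleC_add_right)

lemma scaleC_diff_right: "scaleC c (x - y) = scaleC c x - scaleC c (y::'a::cstar_algebra)"
  using scaleC_add_right[of c x "-y"] by (simp add: scaleC_minus_right)

lemma scaleC_scaleR: "scaleC c (t *\<^sub>R x) = t *\<^sub>R scaleC c (x::'a::cstar_algebra)"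
  by (simp add: scaleR_scaleC scaleC_scaleC mult.commute)

lemma adj_scaleC_i [simp]: "adj (scaleC \<i> x) = - scaleC \<i> (adj (x::'a::cstar_algebra))"
  by (simp add: adj_scaleC scaleC_minus_left)

declare mult_scaleC_left [simp] mult_scaleC_right [simp]

lemma cartesian_decomposition:
  obtains h k :: "'a::cstar_algebra" where "adj h = h" "adj k = k" "x = h + scaleC \<i> k"
proof
  define h where "h = (1/2) *\<^sub>R (x + adj x)"
  define k where "k = (1/2) *\<^sub>R scaleC \<i> (adj x - x)"
  show "adj h = h" by (simp add: h_def add.commute)
  show "adj k = k"
    by (simp add: k_def flip: scaleC_minus_right)
  have "scaleC \<i> k = - ((1/2) *\<^sub>R (adj x - x))"
    by (simp add: k_def scaleC_scaleR flip: scaleR_minus_right)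
  then have "h + scaleC \<i> k = (1/2) *\<^sub>R (x + x)"
    unfolding h_def by (simp only: scaleR_diff_right scaleR_add_right) simp
  also have "\<dots> = x" by (simp flip: scaleR_2)
  finally show "x = h + scaleC \<i> k" by simp
qed

text \<open>For \<open>u = b + ie\<close>, commutation makes \<open>adj u * u\<close> equal to
  \<open>b * b + e * e\<close>, and \<open>b\<close> is the real part of \<open>u\<close>, hence no
  larger in norm.\<close>

lemma norm_commuting_add_i:
  fixes b e :: "'a::cstar_algebra"
  assumes "adj b = b" "adj e = e" "b * e = e * b"
  shows "(norm b)\<^sup>2 \<le> norm (b * b + e * e)"
proof -
  define u where "u = b + scaleC \<i> e"
  have "adj u * u = b * b + e * e"
    using assms by (simp add: u_def algebra_simps scaleC_diff_right scaleC_add_right)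
  then have u: "(norm u)\<^sup>2 = norm (b * b + e * e)" using cstar_identity[of u] by simp
  have "u + adj u = 2 *\<^sub>R b" using assms by (simp add: u_def scaleR_2)
  then have "2 * norm b \<le> norm u + norm u"
    using norm_triangle_ineq[of u "adj u"] by simp
  then have "norm b \<le> norm u" by simp
  then show ?thesis using u by (metis norm_ge_zero power_mono)
qed

text \<open>Writing \<open>c = 1 - x\<close> and \<open>b = 1 - v\<close>, the equation
  \<open>b * b = c\<close> becomes the fixed point equation \<open>v = (x + v * v) / 2\<close>,
  which is solved by iteration from \<open>0\<close>. The iterates are built from \<open>x\<close>
  alone, so the root commutes with whatever commutes with \<open>c\<close>.\<close>

lemma sqrt_near_1:
  fixes c :: "'a::cstar_algebra"
  assumes "adj c = c" "norm (1 - c) \<le> 1"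
  obtains b where "adj b = b" "b * b = c" "norm (1 - b) \<le> 1"
    "\<forall>w. w * c = c * w \<longrightarrow> w * b = b * w"
proof -
  define x where "x = 1 - c"
  define y where "y = rec_nat (0::'a) (\<lambda>_ v. (1/2) *\<^sub>R (x + v * v))"
  \<comment> \<open>The same iteration for the scalar \<open>1\<close>, the largest value of
    \<open>norm x\<close>. It is increasing and bounded by \<open>1\<close>, and its increments
    dominate those of \<open>y\<close>, so \<open>y\<close> is Cauchy even when
    \<open>norm x = 1\<close>.\<close>
  define t where "t = rec_nat (0::real) (\<lambda>_ v. (1/2) * (1 + v * v))"
  have y0: "y 0 = 0" and yS: "y (Suc n) = (1/2) *\<^sub>R (x + y n * y n)" for n
    by (simp_all add: y_def)
  have t0: "t 0 = 0" and tS: "t (Suc n) = (1/2) * (1 + t n * t n)" for n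
    by (simp_all add: t_def)
  have t01: "0 \<le> t n \<and> t n \<le> 1" for n
  proof (induction n)
    case (Suc n)
    then have "t n * t n \<le> 1 * 1" by (intro mult_mono) auto
    then show ?case using Suc by (simp add: tS)
  qed (simp add: t0)
  have x1: "norm x \<le> 1" using assms(2) by (simp add: x_def)
  have comm: "w * y n = y n * w" if "w * x = x * w" for w n
  proof (induction n)
    case (Suc n)
    have "w * (y n * y n) = (y n * y n) * w" by (metis Suc mult.assoc)
    then show ?case using that by (simp add: yS algebra_simps)
  qed (simp add: y0)
  have yy: "y m * y n = y n * y m" for m n
    by (intro comm) (metis comm)
  have norm_y: "norm (y n) \<le> t n" for n
  proof (induction n)
    case (Suc n)
    have "norm (y n * y n) \<le> t n * t n"
      using norm_mult_ineq[of "y n" "y n"] mult_mono[OF Suc Suc] t01[of n] by force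
    then have "norm (x + y n * y n) \<le> 1 + t n * t n"
      using x1 norm_triangle_ineq[of x "y n * y n"] by linarith
    then show ?case by (simp add: yS tS)
  qed (simp add: y0 t0)
  have step: "norm (y (Suc n) - y n) \<le> t (Suc n) - t n" for n
  proof (induction n)
    case 0
    then show ?case using x1 by (simp add: yS y0 tS t0)
  next
    case (Suc n)
    \<comment> \<open>The iterates commute, so the difference of squares factors.\<close>
    have e: "y (Suc (Suc n)) - y (Suc n) = (1/2) *\<^sub>R ((y (Suc n) - y n) * (y (Suc n) + y n))"
      unfolding yS[of "Suc n"] by (subst (3) yS) (simp add: algebra_simps yy[of "Suc n" n])
    have "norm ((y (Suc n) - y n) * (y (Suc n) + y n)) \<le> (t (Suc n) - t n) * (t (Suc n) + t n)"
      using norm_y[of "Suc n"] norm_y[of n] norm_triangle_ineq[of "y (Suc n)" "y n"]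
      by (intro order_trans[OF norm_mult_ineq] mult_mono[OF Suc]) (use order_trans[OF norm_ge_zero Suc] in auto)
    also have "\<dots> = 2 * (t (Suc (Suc n)) - t (Suc n))"
      using tS[of "Suc n"] tS[of n] by (simp add: algebra_simps)
    finally show ?case unfolding e by simp
  qed
  have diff: "norm (y (m + n) - y m) \<le> t (m + n) - t m" for m n
  proof (induction n)
    case (Suc n)
    have "norm (y (m + Suc n) - y m) \<le> norm (y (m + Suc n) - y (m + n)) + norm (y (m + n) - y m)"
      using norm_triangle_ineq[of "y (m + Suc n) - y (m + n)" "y (m + n) - y m"] by simp
    then show ?case using Suc step[of "m + n"] by simp
  qed simp
  have "incseq t" using norm_ge_zero order_trans[OF norm_ge_zero step] by (intro incseq_SucI) simp
  then obtain l where "t \<longlonglongrightarrow> l" using t01 incseq_convergent[of t 1] by blast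
  then have "Cauchy t" using LIMSEQ_imp_Cauchy by blast
  have "Cauchy y"
  proof (rule CauchyI')
    fix e :: real assume "e > 0"
    then obtain M where M: "\<And>m n. m \<ge> M \<Longrightarrow> n \<ge> M \<Longrightarrow> norm (t m - t n) < e"
      using CauchyD[OF \<open>Cauchy t\<close>] by blast
    have "norm (y m - y n) < e" if "m \<ge> M" "m < n" for m n
    proof -
      obtain k where k: "n = m + k" using \<open>m < n\<close> less_imp_add_positive by blast
      have "norm (t m - t n) < e" using M that by simp
      then show ?thesis using diff[of m k] by (simp add: k norm_minus_commute)
    qed
    then show "\<exists>M. \<forall>m\<ge>M. \<forall>n>m. dist (y m) (y n) < e" by (auto simp: dist_norm)
  qed
  then obtain v where v: "y \<longlonglongrightarrow> v" using Cauchy_convergent_iff convergent_def by blast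
  have "(\<lambda>n. y (Suc n)) \<longlonglongrightarrow> (1/2) *\<^sub>R (x + v * v)"
    unfolding yS by (intro tendsto_intros v)
  then have "(1/2) *\<^sub>R (x + v * v) = v"
    using LIMSEQ_Suc[OF v] LIMSEQ_unique by blast
  then have "2 *\<^sub>R v = 2 *\<^sub>R ((1/2) *\<^sub>R (x + v * v))" by simp
  then have vv: "v + v = x + v * v" by (simp add: scaleR_2)
  have "norm v \<le> 1"
    using norm_y t01 by (intro Lim_bounded[OF tendsto_norm[OF v], of 0]) (meson order_trans)
  have "adj (y n) = y n" for n
    by (induction n) (simp_all add: y0 yS x_def assms(1))
  then have "adj v = v" using tendsto_adj[OF v] v LIMSEQ_unique by fastforce
  have "w * v = v * w" if "w * c = c * w" for w
  proof -
    have "w * x = x * w" using that by (simp add: x_def algebra_simps)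
    then have "(\<lambda>n. w * y n) = (\<lambda>n. y n * w)" using comm by blast
    moreover have "(\<lambda>n. w * y n) \<longlonglongrightarrow> w * v" "(\<lambda>n. y n * w) \<longlonglongrightarrow> v * w"
      by (intro tendsto_intros v)+
    ultimately show ?thesis using LIMSEQ_unique by metis
  qed
  then have comm': "\<forall>w. w * c = c * w \<longrightarrow> w * (1 - v) = (1 - v) * w" by (simp add: algebra_simps)
  have sq: "(1 - v) * (1 - v) = c"
  proof -
    have "(1 - v) * (1 - v) = 1 - (v + v) + v * v" by (simp add: algebra_simps)
    then show ?thesis by (simp add: vv x_def)
  qed
  show thesis
    by (rule that[OF _ sq _ comm']) (simp_all add: \<open>adj v = v\<close> \<open>norm v \<le> 1\<close>)
qed

section \<open>Invertibility and a norm criterion for positivity\<close>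

lemma invertible_near_1:
  fixes x :: "'a::cstar_algebra"
  assumes "norm x < 1"
  shows "invertible_el (1 - x)"
proof -
  have s: "summable (\<lambda>n. x ^ n)" using assms by (rule complete_algebra_summable_geometric)
  have h: "(\<Sum>n. x ^ Suc n) = (\<Sum>n. x ^ n) - 1" using suminf_split_head[OF s] by simp
  have "x * (\<Sum>n. x ^ n) = (\<Sum>n. x ^ n) - 1"
    using suminf_mult[OF s, of x] h by simp
  moreover have "(\<Sum>n. x ^ n) * x = (\<Sum>n. x ^ n) - 1"
    using suminf_mult2[OF s, of x] h by (simp add: power_commutes)
  ultimately show ?thesis unfolding invertible_el_def
    by (intro exI[of _ "\<Sum>n. x ^ n"]) (simp add: algebra_simps)
qed

lemma invertible_scaleR:
  assumes "t \<noteq> 0" "invertible_el a"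
  shows "invertible_el (t *\<^sub>R a)"
proof -
  obtain c where "a * c = 1" "c * a = 1" using assms(2) by (auto simp: invertible_el_def)
  then show ?thesis unfolding invertible_el_def using assms(1)
    by (intro exI[of _ "(1/t) *\<^sub>R c"]) simp
qed

text \<open>Positivity without the spectrum: the spectrum of \<open>a\<close> then lies in a disc of
  centre and radius \<open>t\<close>. Sums and nonnegative multiples are immediate in this form;
  \<open>positive_iff_norm_positive\<close> identifies it with \<open>positive_el\<close>.\<close>

definition norm_positive :: "'a::cstar_algebra \<Rightarrow> bool" where
  "norm_positive a \<longleftrightarrow> adj a = a \<and> (\<exists>t. norm (t *\<^sub>R 1 - a) \<le> t)"

lemma norm_positiveI: "adj a = a \<Longrightarrow> norm (t *\<^sub>R 1 - a) \<le> t \<Longrightarrow> norm_positive a"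
  by (auto simp: norm_positive_def)

lemma norm_positive_scaleR:
  assumes "norm_positive a" "s \<ge> 0"
  shows "norm_positive (s *\<^sub>R a)"
proof -
  obtain t where a: "adj a = a" and t: "norm (t *\<^sub>R 1 - a) \<le> t" using assms by (auto simp: norm_positive_def)
  have "norm ((s * t) *\<^sub>R 1 - s *\<^sub>R a) = s * norm (t *\<^sub>R 1 - a)"
    using assms(2) by (metis abs_of_nonneg norm_scaleR scaleR_diff_right scaleR_scaleR)
  also have "\<dots> \<le> s * t" using t assms(2) by (rule mult_left_mono)
  finally show ?thesis using a by (intro norm_positiveI) auto
qed

lemma norm_positive_add:
  assumes "norm_positive a" "norm_positive b"
  shows "norm_positive (a + b)"
proof -
  obtain s t where "adj a = a" "adj b = b" and st: "norm (s *\<^sub>R 1 - a) \<le> s" "norm (t *\<^sub>R 1 - b) \<le> t"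
    using assms by (auto simp: norm_positive_def)
  moreover have "norm ((s + t) *\<^sub>R 1 - (a + b)) \<le> s + t"
    using norm_triangle_ineq[of "s *\<^sub>R 1 - a" "t *\<^sub>R 1 - b"] st by (simp add: algebra_simps)
  ultimately show ?thesis by (intro norm_positiveI) auto
qed

lemma norm_positive_scalar: "s \<ge> 0 \<Longrightarrow> norm_positive (s *\<^sub>R 1)"
  by (rule norm_positiveI[of _ s]) auto

text \<open>Dividing by \<open>t\<close> brings \<open>c\<close> within distance \<open>1\<close> of
  the identity, where \<open>sqrt_near_1\<close> applies; \<open>t = 0\<close> forces
  \<open>c = 0\<close>.\<close>

lemma norm_positive_sqrt:
  fixes c :: "'a::cstar_algebra"
  assumes "norm_positive c"
  obtains b where "norm_positive b" "b * b = c" "\<forall>w. w * c = c * w \<longrightarrow> w * b = b * w"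
proof -
  obtain t where c: "adj c = c" and t: "norm (t *\<^sub>R 1 - c) \<le> t" using assms by (auto simp: norm_positive_def)
  then have "t \<ge> 0" using norm_ge_zero order_trans by blast
  show thesis
  proof (cases "t = 0")
    case True
    then have "c = 0" using t by simp
    then show thesis using that[of 0] norm_positive_scalar[of 0] by simp
  next
    case False
    with \<open>t \<ge> 0\<close> have "t > 0" by simp
    have "norm (1 - (1/t) *\<^sub>R c) = norm ((1/t) *\<^sub>R (t *\<^sub>R 1 - c))"
      using \<open>t > 0\<close> by (simp add: scaleR_diff_right)
    also have "\<dots> \<le> 1" using t \<open>t > 0\<close> by (simp add: divide_simps)
    finally have n: "norm (1 - (1/t) *\<^sub>R c) \<le> 1" .
    have "adj ((1/t) *\<^sub>R c) = (1/t) *\<^sub>R c" using c by simp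
    from sqrt_near_1[OF this n] obtain b where b: "adj b = b" "b * b = (1/t) *\<^sub>R c" "norm (1 - b) \<le> 1"
      "\<forall>w. w * ((1/t) *\<^sub>R c) = (1/t) *\<^sub>R c * w \<longrightarrow> w * b = b * w"
      .
    have "norm_positive b" using b(1,3) by (intro norm_positiveI[of _ 1]) auto
    show thesis
    proof
      show "norm_positive (sqrt t *\<^sub>R b)"
        using \<open>norm_positive b\<close> \<open>t > 0\<close> by (intro norm_positive_scaleR) auto
      show "(sqrt t *\<^sub>R b) * (sqrt t *\<^sub>R b) = c" using b(2) \<open>t > 0\<close> by simp
      show "\<forall>w. w * c = c * w \<longrightarrow> w * (sqrt t *\<^sub>R b) = (sqrt t *\<^sub>R b) * w"
        using b(4) by simp
    qed
  qed
qed

text \<open>For \<open>0 \<le> s - b\<^sup>2 = e\<^sup>2\<close> with \<open>e\<close> commuting with \<open>b\<close>, the element \<open>b + ie\<close> is a multiple of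
  a unitary, which bounds \<open>\<parallel>e\<parallel>\<close>.\<close>

lemma norm_diff_square_le:
  fixes b :: "'a::cstar_algebra"
  assumes "adj b = b" "(norm b)\<^sup>2 \<le> s"
  shows "norm (s *\<^sub>R 1 - b * b) \<le> s"
proof -
  have "s \<ge> 0" using assms(2) by (meson order_trans zero_le_power2)
  have "norm_positive (s *\<^sub>R 1 - b * b)"
    using assms by (intro norm_positiveI[of _ s]) (auto simp: norm_self_adjoint_square)
  then obtain e where "norm_positive e" and ee: "e * e = s *\<^sub>R 1 - b * b"
    and comm: "\<forall>w. w * (s *\<^sub>R 1 - b * b) = (s *\<^sub>R 1 - b * b) * w \<longrightarrow> w * e = e * w"
    by (rule norm_positive_sqrt)
  have "adj e = e" using \<open>norm_positive e\<close> by (simp add: norm_positive_def)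
  have "b * e = e * b" by (rule comm[rule_format]) (simp add: algebra_simps)
  then have "(norm e)\<^sup>2 \<le> norm (e * e + b * b)"
    using norm_commuting_add_i[OF \<open>adj e = e\<close> assms(1)] by simp
  then show ?thesis
    using ee norm_self_adjoint_square[OF \<open>adj e = e\<close>] \<open>s \<ge> 0\<close> by simp
qed

lemma norm_positive_square: "adj b = b \<Longrightarrow> norm_positive (b * b)"
  by (rule norm_positiveI[OF _ norm_diff_square_le]) auto

text \<open>Replaces the unspecified \<open>t\<close> of \<open>norm_positive\<close> by any bound
  of the norm, which makes limits accessible. The square root reduces it to
  \<open>norm_diff_square_le\<close>.\<close>

lemma norm_positive_bound:
  assumes "norm_positive a" "norm a \<le> s"
  shows "norm (s *\<^sub>R 1 - a) \<le> s"
proof -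
  obtain b where b: "norm_positive b" "b * b = a" by (rule norm_positive_sqrt[OF assms(1)])
  then have "adj b = b" by (simp add: norm_positive_def)
  then have "(norm b)\<^sup>2 \<le> s" using assms(2) b norm_self_adjoint_square by metis
  then show ?thesis using norm_diff_square_le \<open>adj b = b\<close> b by blast
qed

text \<open>With the bound \<open>norm a + l\<close> for \<open>a + l\<close>, the shift cancels,
  leaving \<open>norm (norm a *\<^sub>R 1 - a) \<le> norm a + l\<close>; then \<open>l\<close> tends
  to \<open>0\<close>.\<close>

lemma norm_positive_closed:
  fixes a :: "'a::cstar_algebra"
  assumes "adj a = a" "\<And>l. l > 0 \<Longrightarrow> norm_positive (a + l *\<^sub>R 1)"
  shows "norm_positive a"
proof -
  have "norm (norm a *\<^sub>R 1 - a) \<le> norm a + l" if "l > 0" for l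
  proof -
    have "norm (a + l *\<^sub>R 1) \<le> norm a + l"
      using norm_triangle_ineq[of a "l *\<^sub>R 1"] that by simp
    from norm_positive_bound[OF assms(2)[OF that] this]
    show ?thesis by (simp add: algebra_simps)
  qed
  then have "norm (norm a *\<^sub>R 1 - a) \<le> norm a" by (meson field_le_epsilon)
  then show ?thesis using assms(1) norm_positiveI by blast
qed

lemma norm_positive_invertible_add:
  fixes a :: "'a::cstar_algebra"
  assumes "norm_positive a" "l > 0"
  shows "invertible_el (a + l *\<^sub>R 1)"
proof -
  obtain t where t: "norm (t *\<^sub>R 1 - a) \<le> t" using assms by (auto simp: norm_positive_def)
  then have "t \<ge> 0" using norm_ge_zero order_trans by blast
  \<comment> \<open>Factors \<open>a + l\<close> as \<open>(t + l) (1 - x)\<close>, where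
    \<open>norm x \<le> t / (t + l) < 1\<close>.\<close>
  define x where "x = (1/(t + l)) *\<^sub>R (t *\<^sub>R 1 - a)"
  have "norm x < 1" using t \<open>t \<ge> 0\<close> assms(2) by (simp add: x_def divide_simps)
  then have "invertible_el ((t + l) *\<^sub>R (1 - x))"
    using \<open>t \<ge> 0\<close> assms(2) by (intro invertible_scaleR invertible_near_1) auto
  moreover have "(t + l) *\<^sub>R (1 - x) = a + l *\<^sub>R 1"
    using \<open>t \<ge> 0\<close> assms(2) by (simp add: x_def scaleR_diff_right) (simp add: algebra_simps)
  ultimately show ?thesis by simp
qed

text \<open>With \<open>v\<close> inverse to \<open>a\<close> and \<open>d\<close> so small that
  \<open>norm (d v) \<le> 1\<close>, the element \<open>a - d = a (1 - d v)\<close> is the square of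
  \<open>b e\<close>, the product of commuting roots of the two factors.\<close>

lemma norm_positive_invertible_diff:
  fixes a :: "'a::cstar_algebra"
  assumes "norm_positive a" "invertible_el a"
  obtains d where "d > 0" "norm_positive (a - d *\<^sub>R 1)"
proof -
  obtain b where b: "norm_positive b" "b * b = a" by (rule norm_positive_sqrt[OF assms(1)])
  then have "adj b = b" by (simp add: norm_positive_def)
  obtain v where v: "a * v = 1" "v * a = 1" using assms(2) by (auto simp: invertible_el_def)
  have "adj a = a" using assms(1) by (simp add: norm_positive_def)
  have inv_unique: "v' = v" if "v' * a = 1" for v'
    by (metis that v(1) mult.assoc mult.left_neutral mult.right_neutral)
  have "adj v = v"
    using v(1) \<open>adj a = a\<close> by (intro inv_unique) (metis adj_1 adj_mult)
  have "a * b = b * a" using b(2) mult.assoc by metis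
  then have bv: "b * v = v * b" by (metis v mult.assoc mult.left_neutral mult.right_neutral)
  define d where "d = 1 / (norm v + 1)"
  have "norm v + 1 > 0" by (smt (verit) norm_ge_zero)
  then have "d > 0" and d1: "norm (d *\<^sub>R v) \<le> 1" by (simp_all add: d_def divide_simps)
  have "adj (1 - d *\<^sub>R v) = 1 - d *\<^sub>R v" "norm (1 - (1 - d *\<^sub>R v)) \<le> 1"
    using \<open>adj v = v\<close> d1 by simp_all
  from sqrt_near_1[OF this] obtain e where e: "adj e = e" "e * e = 1 - d *\<^sub>R v" "norm (1 - e) \<le> 1"
    and comm: "\<forall>w. w * (1 - d *\<^sub>R v) = (1 - d *\<^sub>R v) * w \<longrightarrow> w * e = e * w" .
  have be: "b * e = e * b" by (rule comm[rule_format]) (simp add: algebra_simps bv)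
  have "(b * e) * (b * e) = b * (e * b) * e" by (simp only: mult.assoc)
  also have "\<dots> = (b * b) * (e * e)" by (simp only: be[symmetric] mult.assoc)
  also have "\<dots> = a - d *\<^sub>R 1" by (simp add: b(2) e(2) right_diff_distrib v)
  finally have 1: "(b * e) * (b * e) = a - d *\<^sub>R 1" .
  have "adj (b * e) = b * e" using be e(1) \<open>adj b = b\<close> by simp
  then have "norm_positive (a - d *\<^sub>R 1)" using norm_positive_square 1 by metis
  then show thesis using that \<open>d > 0\<close> by blast
qed

text \<open>With \<open>k = il\<close>, the product \<open>(b - k) (b + k)\<close> is
  \<open>b * b + l^2\<close>, a positive element shifted by a positive scalar, hence invertible. So
  self-adjoint elements have real spectrum.\<close>

lemma invertible_imaginary_shift:
  fixes b :: "'a::cstar_algebra"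
  assumes "adj b = b" "l \<noteq> 0"
  shows "invertible_el (b - scaleC (\<i> * complex_of_real l) 1)"
proof -
  define k where "k = scaleC (\<i> * complex_of_real l) (1::'a)"
  have kk: "k * k = - ((l\<^sup>2) *\<^sub>R 1)"
  proof -
    have "(\<i> * complex_of_real l) * (\<i> * complex_of_real l) = - complex_of_real (l\<^sup>2)"
      by (simp add: power2_eq_square algebra_simps)
    then show ?thesis
      by (simp only: k_def mult_scaleC_left mult_scaleC_right scaleC_scaleC mult_1_left
        scaleC_minus_left flip: scaleR_scaleC)
  qed
  have kb: "k * b = b * k" by (simp add: k_def)
  have "invertible_el (b * b + l\<^sup>2 *\<^sub>R 1)"
    using assms by (intro norm_positive_invertible_add norm_positive_square) auto
  then obtain v where v: "(b * b + l\<^sup>2 *\<^sub>R 1) * v = 1" "v * (b * b + l\<^sup>2 *\<^sub>R 1) = 1"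
    by (auto simp: invertible_el_def)
  have f: "(b - k) * (b + k) = b * b + l\<^sup>2 *\<^sub>R 1" "(b + k) * (b - k) = b * b + l\<^sup>2 *\<^sub>R 1"
    by (simp_all add: algebra_simps kb kk)
  have 1: "(b - k) * ((b + k) * v) = 1" using f v mult.assoc by metis
  have 2: "(v * (b + k)) * (b - k) = 1" using f v mult.assoc by metis
  have "(b + k) * v = v * (b + k)"
    by (metis 1 2 mult.assoc mult.left_neutral mult.right_neutral)
  then show ?thesis using 1 2 unfolding invertible_el_def k_def by metis
qed

text \<open>Nonreal numbers are never in the spectrum of a self-adjoint element, so only the
  negative reals \<open>- l\<close> have to be excluded.\<close>

lemma positive_iff_invertible:
  "positive_el a \<longleftrightarrow> adj a = a \<and> (\<forall>l>0. invertible_el (a + l *\<^sub>R 1))"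
proof
  assume a: "positive_el a"
  have "invertible_el (a + l *\<^sub>R 1)" if "l > 0" for l
  proof -
    have "complex_of_real (-l) \<notin> spectrum_el a" using a that by (force simp: positive_el_def)
    then have "invertible_el (a - (-l) *\<^sub>R 1)" by (simp only: spectrum_el_def scaleR_scaleC) simp
    then show ?thesis by simp
  qed
  then show "adj a = a \<and> (\<forall>l>0. invertible_el (a + l *\<^sub>R 1))"
    using a by (simp add: positive_el_def self_adjoint_def)
next
  assume a: "adj a = a \<and> (\<forall>l>0. invertible_el (a + l *\<^sub>R 1))"
  have "Im z = 0 \<and> Re z \<ge> 0" if z: "\<not> invertible_el (a - scaleC z 1)" for z
  proof
    have "scaleC z (1::'a) = Re z *\<^sub>R 1 + scaleC (\<i> * complex_of_real (Im z)) 1"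
      by (simp only: scaleR_scaleC flip: scaleC_add_left) (simp add: complex_eq[symmetric])
    then have "a - scaleC z 1 = (a - Re z *\<^sub>R 1) - scaleC (\<i> * complex_of_real (Im z)) 1" by simp
    moreover have "adj (a - Re z *\<^sub>R 1) = a - Re z *\<^sub>R 1" using a by simp
    ultimately show im: "Im z = 0" using z invertible_imaginary_shift by metis
    then have "z = complex_of_real (Re z)" by (simp add: complex_eq_iff)
    then have "scaleC z (1::'a) = Re z *\<^sub>R 1" by (metis scaleR_scaleC)
    then have "\<not> invertible_el (a + (- Re z) *\<^sub>R 1)" using z by simp
    then show "Re z \<ge> 0" using a by (meson neg_0_less_iff_less not_le)
  qed
  then show "positive_el a" using a by (auto simp: positive_el_def self_adjoint_def spectrum_el_def)
qed

text \<open>Starting from a large \<open>l\<close>, the norm positivity of \<open>a + l\<close> persists when \<open>l\<close> decreases to \<open>0\<close>,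
  because it is both a closed condition and, as long as \<open>a + l\<close> is invertible, an open one.\<close>

lemma positive_iff_norm_positive: "positive_el a \<longleftrightarrow> norm_positive (a::'a::cstar_algebra)"
proof
  assume "norm_positive a"
  then show "positive_el a"
    using norm_positive_invertible_add by (auto simp: positive_iff_invertible norm_positive_def)
next
  assume "positive_el a"
  then have a: "adj a = a" and inv: "\<And>l. l > 0 \<Longrightarrow> invertible_el (a + l *\<^sub>R 1)"
    by (auto simp: positive_iff_invertible)
  define L where "L = {l. l \<ge> 0 \<and> norm_positive (a + l *\<^sub>R 1)}"
  have "norm a \<in> L" unfolding L_def using a by (auto intro!: norm_positiveI[of _ "norm a"])
  have bdd: "bdd_below L" by (auto simp: L_def intro: bdd_belowI)
  define l0 where "l0 = Inf L"
  have "l0 \<ge> 0" unfolding l0_def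
  proof (rule cInf_greatest)
    show "L \<noteq> {}" using \<open>norm a \<in> L\<close> by blast
  qed (simp add: L_def)
  have pos: "norm_positive (a + l0 *\<^sub>R 1)"
  proof (rule norm_positive_closed)
    fix m :: real assume "m > 0"
    then obtain l where l: "l \<in> L" "l < l0 + m"
      using cInf_lessD[of L "l0 + m"] \<open>norm a \<in> L\<close> unfolding l0_def by auto
    have "norm_positive ((a + l *\<^sub>R 1) + (l0 + m - l) *\<^sub>R 1)"
      by (rule norm_positive_add[OF _ norm_positive_scalar]) (use l in \<open>auto simp: L_def\<close>)
    then show "norm_positive (a + l0 *\<^sub>R 1 + m *\<^sub>R 1)" by (simp add: algebra_simps)
  qed (simp add: a)
  have "l0 = 0"
  proof (rule ccontr)
    assume "l0 \<noteq> 0"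
    with \<open>l0 \<ge> 0\<close> have "l0 > 0" by simp
    from norm_positive_invertible_diff[OF pos inv[OF this]]
    obtain d where d: "d > 0" "norm_positive (a + l0 *\<^sub>R 1 - d *\<^sub>R 1)" .
    \<comment> \<open>The descent is capped at \<open>l0\<close>, because members of
      \<open>L\<close> are nonnegative.\<close>
    have "norm_positive ((a + l0 *\<^sub>R 1 - d *\<^sub>R 1) + (d - min d l0) *\<^sub>R 1)"
      by (rule norm_positive_add[OF _ norm_positive_scalar]) (use d in auto)
    then have "l0 - min d l0 \<in> L" by (simp add: L_def algebra_simps)
    then have "l0 \<le> l0 - min d l0" unfolding l0_def[symmetric] using cInf_lower[OF _ bdd] l0_def by blast
    then show False using d \<open>l0 > 0\<close> by auto
  qed
  then show "norm_positive a" using pos by simp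
qed

section \<open>Order properties of positive elements\<close>

lemma positive_adj: "positive_el a \<Longrightarrow> adj a = a"
  by (simp add: positive_el_def self_adjoint_def)

lemma positive_sqrt:
  assumes "positive_el c"
  obtains b where "positive_el b" "b * b = c" "\<forall>w. w * c = c * w \<longrightarrow> w * b = b * w"
  using norm_positive_sqrt[OF assms[unfolded positive_iff_norm_positive]]
  unfolding positive_iff_norm_positive by blast

lemma positive_square: "adj b = b \<Longrightarrow> positive_el (b * b)"
  by (simp add: positive_iff_norm_positive norm_positive_square)

lemma positive_add: "positive_el a \<Longrightarrow> positive_el b \<Longrightarrow> positive_el (a + b)"
  by (simp add: positive_iff_norm_positive norm_positive_add)

lemma positive_scaleR: "positive_el a \<Longrightarrow> s \<ge> 0 \<Longrightarrow> positive_el (s *\<^sub>R a)"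
  by (simp add: positive_iff_norm_positive norm_positive_scaleR)

lemma positive_scalar: "s \<ge> 0 \<Longrightarrow> positive_el (s *\<^sub>R 1)"
  by (simp add: positive_iff_norm_positive norm_positive_scalar)

lemma positive_0 [simp]: "positive_el 0"
  using positive_scalar[of 0] by simp

lemma positive_closed:
  "adj a = a \<Longrightarrow> (\<And>l. l > 0 \<Longrightarrow> positive_el (a + l *\<^sub>R 1)) \<Longrightarrow> positive_el a"
  by (simp add: positive_iff_norm_positive norm_positive_closed)

lemma positive_norm_diff: "adj a = a \<Longrightarrow> norm a \<le> s \<Longrightarrow> positive_el (s *\<^sub>R 1 - a)"
  unfolding positive_iff_norm_positive by (rule norm_positiveI[of _ s]) auto

text \<open>Strict positivity as a scalar gap; through \<open>op_lt_iff\<close> this is how strict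
  inequalities enter the estimates below.\<close>

lemma positive_invertible_iff:
  "positive_el a \<and> invertible_el a \<longleftrightarrow> (\<exists>d>0. positive_el (a - d *\<^sub>R 1))"
proof
  assume "positive_el a \<and> invertible_el a"
  then show "\<exists>d>0. positive_el (a - d *\<^sub>R 1)"
    unfolding positive_iff_norm_positive by (blast elim: norm_positive_invertible_diff)
next
  assume "\<exists>d>0. positive_el (a - d *\<^sub>R 1)"
  then obtain d where d: "d > 0" "positive_el (a - d *\<^sub>R 1)" by blast
  then show "positive_el a \<and> invertible_el a"
    using positive_add[OF d(2) positive_scalar[of d]]
      norm_positive_invertible_add[of "a - d *\<^sub>R 1" d] by (simp add: positive_iff_norm_positive)
qed

text \<open>Commuting roots of \<open>a\<close> and \<open>- a\<close> have squares that add up to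
  \<open>0\<close>, so \<open>norm_commuting_add_i\<close> makes the first root vanish.\<close>

lemma positive_antisym:
  assumes "positive_el a" "positive_el (- a)"
  shows "a = 0"
proof -
  obtain b where b: "positive_el b" "b * b = a" by (rule positive_sqrt[OF assms(1)])
  obtain c where c: "positive_el c" "c * c = - a" and comm: "\<forall>w. w * (- a) = (- a) * w \<longrightarrow> w * c = c * w"
    by (rule positive_sqrt[OF assms(2)])
  have "b * c = c * b" by (rule comm[rule_format]) (simp add: b(2)[symmetric] mult.assoc)
  then have "(norm b)\<^sup>2 \<le> norm (b * b + c * c)"
    using b c norm_commuting_add_i positive_adj by blast
  then show ?thesis using b c by simp
qed

text \<open>Commuting roots of \<open>a\<close> and of \<open>s - a\<close> have squares adding up
  to \<open>s\<close>, so \<open>norm_commuting_add_i\<close> applies; \<open>s \<ge> 0\<close>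
  follows from antisymmetry.\<close>

lemma norm_le_of_between:
  assumes "positive_el a" "positive_el (s *\<^sub>R 1 - a)"
  shows "norm a \<le> s"
proof -
  obtain b where b: "positive_el b" "b * b = a" by (rule positive_sqrt[OF assms(1)])
  obtain c where c: "positive_el c" "c * c = s *\<^sub>R 1 - a"
    and comm: "\<forall>w. w * (s *\<^sub>R 1 - a) = (s *\<^sub>R 1 - a) * w \<longrightarrow> w * c = c * w"
    by (rule positive_sqrt[OF assms(2)])
  have "b * c = c * b" by (rule comm[rule_format]) (simp add: b(2)[symmetric] algebra_simps)
  then have "(norm b)\<^sup>2 \<le> \<bar>s\<bar>"
    using norm_commuting_add_i[of b c] b c positive_adj[of b] positive_adj[of c] by simp
  moreover have "s \<ge> 0"
  proof (rule ccontr)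
    assume "\<not> s \<ge> 0"
    then have "positive_el (- (s *\<^sub>R 1) :: 'a)" using positive_scalar[of "-s"] by simp
    moreover have "positive_el (s *\<^sub>R 1 :: 'a)" using positive_add[OF assms] by simp
    ultimately have "s *\<^sub>R 1 = (0::'a)" using positive_antisym by blast
    then show False using \<open>\<not> s \<ge> 0\<close> by simp
  qed
  ultimately show ?thesis using b norm_self_adjoint_square[of b] positive_adj[of b] by simp
qed

text \<open>Positivity passes from \<open>- (adj y * y)\<close> to \<open>- (y * adj y)\<close>,
  since invertibility of \<open>l - adj y * y\<close> implies that of \<open>l - y * adj y\<close>.
  As \<open>adj y * y + y * adj y = 2 (h * h + k * k)\<close> is positive for the cartesian parts of
  \<open>y\<close>, \<open>adj y * y\<close> is then positive too, hence \<open>0\<close>.\<close>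

lemma negative_adj_mult_eq_0:
  fixes y :: "'a::cstar_algebra"
  assumes "positive_el (- (adj y * y))"
  shows "y = 0"
proof -
  have "positive_el (- (y * adj y))"
    unfolding positive_iff_invertible
  proof (intro conjI allI impI)
    fix l :: real assume l: "l > 0"
    then obtain v where v: "(- (adj y * y) + l *\<^sub>R 1) * v = 1" "v * (- (adj y * y) + l *\<^sub>R 1) = 1"
      using assms by (auto simp: positive_iff_invertible invertible_el_def)
    then have v': "adj y * (y * v) = l *\<^sub>R v - 1" "v * (adj y * y) = l *\<^sub>R v - 1"
      by (simp_all add: algebra_simps)
    \<comment> \<open>Up to the factor \<open>1 / l\<close> this is the inverse of
      \<open>l - y * adj y\<close>.\<close>
    define w where "w = 1 + y * v * adj y"
    have 1: "y * adj y * w = l *\<^sub>R (w - 1)"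
    proof -
      have "y * adj y * w = y * adj y + y * (adj y * (y * v)) * adj y"
        by (simp add: w_def algebra_simps)
      then show ?thesis unfolding v' by (simp add: w_def algebra_simps)
    qed
    have 2: "w * (y * adj y) = l *\<^sub>R (w - 1)"
    proof -
      have "w * (y * adj y) = y * adj y + y * (v * (adj y * y)) * adj y"
        by (simp add: w_def algebra_simps)
      then show ?thesis unfolding v' by (simp add: w_def algebra_simps)
    qed
    have "(- (y * adj y) + l *\<^sub>R 1) * w = l *\<^sub>R 1" "w * (- (y * adj y) + l *\<^sub>R 1) = l *\<^sub>R 1"
      using 1 2 by (simp_all add: algebra_simps)
    then have "(- (y * adj y) + l *\<^sub>R 1) * ((1/l) *\<^sub>R w) = 1"
         "((1/l) *\<^sub>R w) * (- (y * adj y) + l *\<^sub>R 1) = 1"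
      using l by (simp_all only: mult_scaleR_left mult_scaleR_right) simp_all
    then show "invertible_el (- (y * adj y) + l *\<^sub>R 1)" unfolding invertible_el_def by blast
  qed simp
  moreover obtain h k :: 'a where hk: "adj h = h" "adj k = k" "y = h + scaleC \<i> k"
    by (rule cartesian_decomposition)
  have "adj y * y + y * adj y = 2 *\<^sub>R (h * h + k * k)"
    using hk by (simp add: algebra_simps scaleR_2 scaleC_diff_right scaleC_add_right)
  then have "adj y * y = 2 *\<^sub>R (h * h + k * k) + - (y * adj y)" by (simp add: algebra_simps)
  ultimately have "positive_el (adj y * y)"
    using hk by (simp del: add_uminus_conv_diff add: positive_add positive_scaleR positive_square)
  then show ?thesis using assms positive_antisym adj_mult_self_eq_0 by blast
qed

text \<open>With \<open>c = x\<^sup>* x\<close> and \<open>d = \<bar>c\<bar> - c\<close>, twice the negative part of \<open>c\<close>, the element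
  \<open>y = x d\<close> satisfies \<open>y\<^sup>* y = d c d = - d\<^sup>3 / 2 \<le> 0\<close>, so \<open>d = 0\<close>.\<close>

lemma positive_adj_mult: "positive_el (adj x * (x::'a::cstar_algebra))"
proof -
  define c where "c = adj x * x"
  have cs: "adj c = c" by (simp add: c_def)
  obtain m where m: "positive_el m" "m * m = c * c" and mc: "\<forall>w. w * (c * c) = (c * c) * w \<longrightarrow> w * m = m * w"
    by (rule positive_sqrt[OF positive_square[OF cs]])
  \<comment> \<open>The root \<open>s\<close> serves to write \<open>d * (m * d)\<close> as the
    square of the self-adjoint element \<open>s * d\<close>.\<close>
  obtain s where s: "positive_el s" "s * s = m" and sc: "\<forall>w. w * m = m * w \<longrightarrow> w * s = s * w"
    by (rule positive_sqrt[OF m(1)])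
  define d where "d = m - c"
  have cm: "c * m = m * c" by (rule mc[rule_format]) (simp add: mult.assoc)
  then have cs': "c * s = s * c" by (rule sc[rule_format])
  have "m * s = s * m" using sc by blast
  then have ds: "d * s = s * d" using cs' by (simp add: d_def algebra_simps)
  have da: "adj d = d" using cs positive_adj[OF m(1)] by (simp add: d_def)
  have cd: "c * d = - (m * d)" by (simp add: d_def algebra_simps m cm)
  have "d * d = 2 *\<^sub>R (m * d)" using cd by (simp add: d_def algebra_simps scaleR_2)
  then have dd: "m * d = (1/2) *\<^sub>R (d * d)" by simp
  have "adj (x * d) * (x * d) = d * (c * d)" by (simp add: c_def mult.assoc da)
  then have "- (adj (x * d) * (x * d)) = d * (m * d)" by (simp add: cd)
  also have "\<dots> = (s * d) * (s * d)"
    by (metis ds s(2) mult.assoc)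
  finally have e: "- (adj (x * d) * (x * d)) = (s * d) * (s * d)" .
  have "adj (s * d) = s * d" using ds da positive_adj[OF s(1)] by simp
  then have "positive_el (- (adj (x * d) * (x * d)))" unfolding e by (rule positive_square)
  then have "x * d = 0" by (rule negative_adj_mult_eq_0)
  then have "d * (m * d) = 0" using cd by (simp add: c_def mult.assoc)
  then have "d * (d * d) = 0" by (simp add: dd)
  then have "adj (d * d) * (d * d) = 0" by (metis da adj_mult mult.assoc mult_zero_right)
  then have "d * d = 0" using adj_mult_self_eq_0 by blast
  then have "d = 0" using adj_mult_self_eq_0[of d] da by simp
  then show ?thesis using m by (simp add: d_def flip: c_def)
qed

lemma positive_conj:
  assumes "positive_el a"
  shows "positive_el (adj x * a * x)"
proof -
  obtain b where b: "positive_el b" "b * b = a" by (rule positive_sqrt[OF assms])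
  then have "adj x * a * x = adj (b * x) * (b * x)" by (simp add: positive_adj[OF b(1)] mult.assoc flip: b(2))
  then show ?thesis using positive_adj_mult by metis
qed

text \<open>With \<open>b\<close> a root of \<open>a\<close>, the element is
  \<open>b (s - a) b\<close>. It bounds \<open>a * a\<close> by a multiple of
  \<open>a\<close>.\<close>

lemma positive_diff_square:
  assumes "positive_el a" "norm a \<le> s"
  shows "positive_el (s *\<^sub>R a - a * a)"
proof -
  obtain b where b: "positive_el b" "b * b = a" by (rule positive_sqrt[OF assms(1)])
  have "positive_el (adj b * (s *\<^sub>R 1 - a) * b)"
    using assms positive_adj by (intro positive_conj positive_norm_diff) auto
  also have "adj b * (s *\<^sub>R 1 - a) * b = s *\<^sub>R a - a * a"
    by (simp add: positive_adj[OF b(1)] algebra_simps flip: b(2))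
  finally show ?thesis .
qed

section \<open>Central projections and suprema\<close>

lemma op_le_refl [simp]: "op_le a a"
  by (simp add: op_le_def)

lemma op_le_trans: "op_le a b \<Longrightarrow> op_le b c \<Longrightarrow> op_le a c"
  using positive_add[of "c - b" "b - a"] by (simp add: op_le_def)

lemma op_le_antisym: "op_le a b \<Longrightarrow> op_le b a \<Longrightarrow> a = b"
  using positive_antisym[of "b - a"] by (simp add: op_le_def)

lemma op_le_add_iff [simp]: "op_le (c + a) (c + b) \<longleftrightarrow> op_le a b"
  by (simp add: op_le_def)

lemma op_le_scaleR: "op_le a b \<Longrightarrow> t \<ge> 0 \<Longrightarrow> op_le (t *\<^sub>R a) (t *\<^sub>R b)"
  using positive_scaleR[of "b - a" t] by (simp add: op_le_def scaleR_diff_right)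

lemma op_le_add: "op_le a b \<Longrightarrow> op_le c d \<Longrightarrow> op_le (a + c) (b + d)"
  using positive_add[of "b - a" "d - c"] by (simp add: op_le_def algebra_simps)

lemma op_lt_iff: "op_lt a b \<longleftrightarrow> (\<exists>d>0. op_le (a + d *\<^sub>R 1) b)"
  using positive_invertible_iff[of "b - a"] by (simp add: op_lt_def op_le_def algebra_simps)

definition central_projection :: "'a::cstar_algebra \<Rightarrow> bool" where
  "central_projection r \<longleftrightarrow> is_projection r \<and> is_central r"

lemma central_projection_idem: "central_projection r \<Longrightarrow> r * r = r"
  by (simp add: central_projection_def is_projection_def)

lemma central_projection_idem_left: "central_projection r \<Longrightarrow> r * (r * a) = r * a"
  by (metis central_projection_idem mult.assoc)

lemma central_projection_adj: "central_projection r \<Longrightarrow> adj r = r"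
  by (simp add: central_projection_def is_projection_def)

lemma central_projection_commute: "central_projection r \<Longrightarrow> r * a = a * r"
  by (simp add: central_projection_def is_central_def)

lemma central_projection_perp:
  assumes "central_projection r"
  shows "central_projection (1 - r)"
proof -
  have "(1 - r) * (1 - r) = 1 - r"
    using central_projection_idem[OF assms] by (simp add: algebra_simps)
  moreover have "(1 - r) * x = x * (1 - r)" for x
    by (simp only: left_diff_distrib right_diff_distrib central_projection_commute[OF assms, of x]) simp
  moreover have "adj (1 - r) = 1 - r" using central_projection_adj[OF assms] by simp
  ultimately show ?thesis
    unfolding central_projection_def is_projection_def is_central_def by blast
qed

lemma central_projection_mult_perp: "central_projection r \<Longrightarrow> r * ((1 - r) * a) = 0"
  by (simp add: left_diff_distrib right_diff_distrib central_projection_idem_left)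

lemma central_projection_perp_mult: "central_projection r \<Longrightarrow> (1 - r) * (r * a) = 0"
  by (simp add: left_diff_distrib central_projection_idem_left)

lemmas central_projection_simps = central_projection_idem_left central_projection_mult_perp
  central_projection_perp_mult central_projection_idem_left[OF central_projection_perp]

lemma positive_central_mult:
  assumes "central_projection r" "positive_el a"
  shows "positive_el (r * a)"
proof -
  have "adj r * a * r = r * a"
    using assms(1) by (metis central_projection_adj central_projection_commute central_projection_idem mult.assoc)
  then show ?thesis using positive_conj[OF assms(2), of r] by simp
qed

lemma op_le_central_mult: "central_projection r \<Longrightarrow> op_le a b \<Longrightarrow> op_le (r * a) (r * b)"
  using positive_central_mult[of r "b - a"] by (simp add: op_le_def right_diff_distrib)

text \<open>Many inequalities below are proved on the two summands cut out by \<open>r\<close>;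
  \<open>op_le_central_mult\<close> goes the other way.\<close>

lemma op_le_split:
  assumes "op_le (r * a) (r * b)" "op_le ((1 - r) * a) ((1 - r) * b)"
  shows "op_le a b"
  using op_le_add[OF assms] by (simp flip: distrib_right)

lemma eq_split: "r * a = r * b \<Longrightarrow> (1 - r) * a = (1 - r) * b \<Longrightarrow> a = (b::'a::cstar_algebra)"
  by (simp add: left_diff_distrib)

text \<open>The hypothesis \<open>ideal\<close> makes the right annihilator invariant under left
  multiplication, so it contains \<open>x * r\<close>, that is, \<open>r * (x * r) = x * r\<close>.
  Taking adjoints gives \<open>r * x * r = r * x\<close>, so \<open>r\<close> is central.\<close>

lemma annihilator_central:
  fixes F :: "'a::cstar_algebra set"
  assumes "AW_algebra TYPE('a)" "F \<noteq> {}"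
    and ideal: "\<And>f x a. f \<in> F \<Longrightarrow> \<forall>g\<in>F. g * a = 0 \<Longrightarrow> f * (x * a) = 0"
  obtains r where "central_projection r" "\<forall>a. (\<forall>f\<in>F. f * a = 0) \<longleftrightarrow> r * a = a"
proof -
  obtain r where r: "is_projection r" "{a. \<forall>b\<in>F. b * a = 0} = left_mult_set r UNIV"
    using assms(1)[unfolded AW_algebra_def, THEN spec, THEN mp, OF assms(2)] by (elim exE conjE)
  have rr: "r * r = r" "adj r = r" using r(1) by (auto simp: is_projection_def)
  have iff: "(\<forall>f\<in>F. f * a = 0) \<longleftrightarrow> r * a = a" for a
  proof -
    have "(\<forall>f\<in>F. f * a = 0) \<longleftrightarrow> a \<in> left_mult_set r UNIV" using r(2) by blast
    also have "\<dots> \<longleftrightarrow> r * a = a"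
    proof
      assume "a \<in> left_mult_set r UNIV"
      then obtain c where "a = r * c" by (auto simp: left_mult_set_def)
      then show "r * a = a" using rr(1) by (simp flip: mult.assoc)
    next
      assume "r * a = a"
      then show "a \<in> left_mult_set r UNIV" unfolding left_mult_set_def by (metis rangeI)
    qed
    finally show ?thesis .
  qed
  have xr: "r * (x * r) = x * r" for x
  proof -
    have "\<forall>f\<in>F. f * r = 0" unfolding iff by (rule rr)
    then have "\<forall>f\<in>F. f * (x * r) = 0" using ideal by blast
    then show ?thesis unfolding iff .
  qed
  have "r * x = x * r" for x
  proof -
    have "adj (r * (adj x * r)) = adj (adj x * r)" by (simp only: xr)
    then have "r * x * r = r * x" using rr by simp
    then show ?thesis using xr[of x] by (simp add: mult.assoc)
  qed
  then have "central_projection r" using r(1) by (simp add: central_projection_def is_central_def)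
  then show thesis by (rule that) (simp add: iff)
qed

text \<open>The projection generates the annihilator of all commutators. A central projection
  \<open>z\<close> cuts out a commutative summand exactly if \<open>r * z = z\<close>, so
  \<open>r\<close> is the largest such projection and is the one that \<open>pA1\<close>
  denotes.\<close>

lemma pA1_properties:
  assumes "AW_algebra TYPE('a::cstar_algebra)"
  shows "central_projection (pA1 TYPE('a))"
    and "(\<forall>x y. (x * y - y * x) * a = 0) \<longleftrightarrow> pA1 TYPE('a) * a = (a::'a)"
proof -
  define F where "F = {x * y - y * x | x y :: 'a. True}"
  have "F \<noteq> {}" by (auto simp: F_def)
  moreover have "f * (c * a) = 0" if fF: "f \<in> F" and fa: "\<forall>g\<in>F. g * a = 0" for f c a :: 'a
  proof -
    obtain x y where f: "f = x * y - y * x" using fF unfolding F_def by blast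
    have "(x * (y * c) - (y * c) * x) * a = 0" "(x * c - c * x) * a = 0"
      using fa by (auto simp: F_def)
    \<comment> \<open>The identity \<open>[x, y] c = [x, y c] - y [x, c]\<close> shows that the
      annihilator of the commutators is stable under left multiplication.\<close>
    moreover have "f * (c * a) = (x * (y * c) - (y * c) * x) * a - y * ((x * c - c * x) * a)"
      by (simp add: f algebra_simps)
    ultimately show ?thesis by simp
  qed
  ultimately obtain r where r: "central_projection r" "\<forall>a. (\<forall>f\<in>F. f * a = 0) \<longleftrightarrow> r * a = a"
    by (rule annihilator_central[OF assms])
  have iff: "(\<forall>x y. (x * y - y * x) * a = 0) \<longleftrightarrow> r * a = a" for a
    unfolding r(2)[rule_format, symmetric] F_def by blast
  have comm_iff: "commutative_set (left_mult_set z UNIV) \<longleftrightarrow> r * z = z" if "central_projection z" for z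
  proof -
    have "(z * x) * (z * y) = (x * y) * z" for x y
      by (metis that central_projection_commute central_projection_idem_left mult.assoc)
    then have "commutative_set (left_mult_set z UNIV) \<longleftrightarrow> (\<forall>x y. (x * y) * z = (y * x) * z)"
      by (auto simp: commutative_set_def left_mult_set_def)
    then show ?thesis by (simp add: left_diff_distrib flip: iff)
  qed
  let ?P = "\<lambda>p :: 'a. is_projection p \<and> is_central p
       \<and> commutative_set (left_mult_set p UNIV)
       \<and> \<not> (\<exists>z. is_projection z \<and> is_central z \<and> z \<noteq> 0 \<and> op_le z (perp p)
                \<and> commutative_set (left_mult_set z UNIV))"
  have "pA1 TYPE('a) = r"
    unfolding pA1_def
  proof (rule the_equality)
    have "z = 0" if z: "central_projection z" "op_le z (perp r)" "commutative_set (left_mult_set z UNIV)" for z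
    proof -
      have rz: "r * z = z" using comm_iff z by blast
      have "op_le (z * z) (z * perp r)" using z(1,2) by (rule op_le_central_mult)
      moreover have "z * perp r = 0"
        using rz central_projection_commute[OF r(1), of z] by (simp add: perp_def right_diff_distrib)
      ultimately have "op_le z 0" by (simp add: central_projection_idem[OF z(1)])
      moreover have "op_le 0 z"
        using positive_square[of z] z(1) by (simp add: op_le_def central_projection_idem central_projection_adj)
      ultimately show ?thesis by (rule op_le_antisym)
    qed
    then show "?P r" using r(1) comm_iff[OF r(1)] central_projection_idem[OF r(1)]
      by (auto simp: central_projection_def)
  next
    fix p assume p: "?P p"
    then have cp: "central_projection p" by (simp add: central_projection_def)
    then have rp: "r * p = p" using p comm_iff by blast
    \<comment> \<open>The part of \<open>r\<close> outside \<open>p\<close> is a commutative summand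
      orthogonal to \<open>p\<close>, which \<open>?P p\<close> only allows to be
      \<open>0\<close>.\<close>
    define z where "z = r - p"
    have pr: "p * r = p" using rp central_projection_commute[OF cp] by simp
    have "is_projection z"
      using rp pr r(1) cp by (simp add: is_projection_def z_def algebra_simps
          central_projection_idem central_projection_adj)
    moreover have "is_central z"
      unfolding is_central_def z_def left_diff_distrib right_diff_distrib
      using central_projection_commute[OF r(1)] central_projection_commute[OF cp] by metis
    moreover have "op_le z (perp p)"
      using positive_square[of "1 - r"] central_projection_perp[OF r(1)]
      by (simp add: op_le_def z_def perp_def central_projection_idem central_projection_adj del: adj_diff)
    moreover have "r * z = z"
      using rp r(1) by (simp add: z_def right_diff_distrib central_projection_idem)
    ultimately have "z = 0" using p comm_iff[of z] by (auto simp: central_projection_def)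
    then show "p = r" by (simp add: z_def)
  qed
  then show "central_projection (pA1 TYPE('a))"
    "(\<forall>x y. (x * y - y * x) * a = 0) \<longleftrightarrow> pA1 TYPE('a) * a = (a::'a)"
    using r(1) iff by auto
qed

section \<open>Suprema and centrality\<close>

definition is_sup_on :: "'a::cstar_algebra set \<Rightarrow> 'a \<Rightarrow> 'a \<Rightarrow> 'a \<Rightarrow> bool" where
  "is_sup_on I a b s \<longleftrightarrow> s \<in> I \<and> op_le a s \<and> op_le b s
     \<and> (\<forall>u\<in>I. op_le a u \<longrightarrow> op_le b u \<longrightarrow> op_le s u)"

text \<open>By completing the square, \<open>w = h u - h\<^sup>2 v\<close> satisfies \<open>w \<le> a\<^sup>2 \<le> N a\<close> and
  \<open>w \<le> b\<^sup>2 \<le> N b\<close>. Hence \<open>w \<le> 0\<close>; letting \<open>h\<close> tend to \<open>0\<close> gives \<open>u \<le> 0\<close>; now replace \<open>x\<close> by \<open>- x\<close> and \<open>ix\<close>.\<close>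

lemma inf_0_imp_mult_0:
  fixes a b :: "'a::cstar_algebra"
  assumes pos: "positive_el a" "positive_el b"
    and inf: "\<And>w. adj w = w \<Longrightarrow> op_le w a \<Longrightarrow> op_le w b \<Longrightarrow> op_le w 0"
  shows "a * x * b = 0"
proof -
  have ab: "adj a = a" "adj b = b" using pos positive_adj by auto
  define N where "N = max (norm a) (norm b) + 1"
  have N: "norm a \<le> N" "norm b \<le> N" by (auto simp: N_def)
  have "N > 0" unfolding N_def by (smt (verit) norm_ge_zero)
  have main: "positive_el (- (a * x * b + b * adj x * a))" for x
  proof -
    define u where "u = a * x * b + b * adj x * a"
    define v where "v = b * adj x * x * b + a * x * adj x * a"
    have uv: "adj u = u" "adj v = v" by (simp_all add: u_def v_def ab mult.assoc add.commute)
    have hv: "positive_el (h *\<^sub>R v - u)" if "h > 0" for h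
    proof -
      define w where "w = h *\<^sub>R u - (h * h) *\<^sub>R v"
      \<comment> \<open>The second square supplies the term of \<open>v\<close> that completing the
        square leaves out, so that one and the same \<open>w\<close> is bounded by
        \<open>a * a\<close> and by \<open>b * b\<close>.\<close>
      have "adj (a - h *\<^sub>R (x * b)) * (a - h *\<^sub>R (x * b)) + adj (h *\<^sub>R (adj x * a)) * (h *\<^sub>R (adj x * a)) = a * a - w"
        by (simp add: w_def u_def v_def ab algebra_simps)
      then have "positive_el (a * a - w)" using positive_adj_mult positive_add by metis
      from positive_add[OF positive_diff_square[OF pos(1) N(1)] this]
      have wa: "positive_el (N *\<^sub>R a - w)" by simp
      have "adj (b - h *\<^sub>R (adj x * a)) * (b - h *\<^sub>R (adj x * a)) + adj (h *\<^sub>R (x * b)) * (h *\<^sub>R (x * b)) = b * b - w"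
        by (simp add: w_def u_def v_def ab algebra_simps)
      then have "positive_el (b * b - w)" using positive_adj_mult positive_add by metis
      from positive_add[OF positive_diff_square[OF pos(2) N(2)] this]
      have wb: "positive_el (N *\<^sub>R b - w)" by simp
      have "op_le ((1/N) *\<^sub>R w) a" "op_le ((1/N) *\<^sub>R w) b"
        using positive_scaleR[OF wa, of "1/N"] positive_scaleR[OF wb, of "1/N"] \<open>N > 0\<close>
        by (simp_all add: op_le_def scaleR_diff_right)
      then have "op_le ((1/N) *\<^sub>R w) 0" by (intro inf) (simp_all add: w_def uv)
      then have "positive_el ((N / h) *\<^sub>R (- ((1/N) *\<^sub>R w)))"
        using \<open>N > 0\<close> that by (intro positive_scaleR) (auto simp: op_le_def)
      moreover have "(N / h) *\<^sub>R (- ((1/N) *\<^sub>R w)) = h *\<^sub>R v - u"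
        using \<open>N > 0\<close> that by (simp add: w_def scaleR_diff_right)
      ultimately show ?thesis by simp
    qed
    have "positive_el (- u)"
    proof (rule positive_closed)
      fix l :: real assume "l > 0"
      define h where "h = l / (norm v + 1)"
      have "norm v + 1 > 0" by (smt (verit) norm_ge_zero)
      then have "h > 0" and n: "norm (h *\<^sub>R v) \<le> l" using \<open>l > 0\<close> by (simp_all add: h_def divide_simps)
      have "positive_el (l *\<^sub>R 1 - h *\<^sub>R v)" by (rule positive_norm_diff[OF _ n]) (simp add: uv)
      from positive_add[OF this hv[OF \<open>h > 0\<close>]] show "positive_el (- u + l *\<^sub>R 1)" by simp
    qed (simp add: uv)
    then show ?thesis by (simp add: u_def)
  qed
  have zero: "a * x * b + b * adj x * a = 0" for x
    using positive_antisym[of "a * x * b + b * adj x * a"] main[of x] main[of "-x"]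
    by (simp add: add.commute)
  have "scaleC \<i> (a * x * b - b * adj x * a) = 0"
    using zero[of "scaleC \<i> x"] by (simp add: scaleC_diff_right)
  then have "a * x * b = b * adj x * a"
    by (metis eq_iff_diff_eq_0 neg_equal_0_iff_equal scaleC_i_i scaleC_scaleR scaleR_zero_left)
  then have "2 *\<^sub>R (a * x * b) = 0" using zero[of x] by (simp add: scaleR_2)
  then show ?thesis by simp
qed

text \<open>The gaps \<open>a = s - z\<close> and \<open>b = s - y\<close> have infimum
  \<open>0\<close>: subtracting a common lower bound from \<open>s\<close> gives another upper
  bound. So \<open>a x b = 0\<close> for all \<open>x\<close>, and the central projection
  \<open>r\<close> that generates the annihilator of the right ideal of \<open>a\<close> satisfies
  \<open>r * a = 0\<close> and \<open>r * b = b\<close>.\<close>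

lemma sup_central_comparison:
  fixes y z :: "'a::cstar_algebra"
  assumes AW: "AW_algebra TYPE('a)" and sa: "adj y = y" "adj z = z" and sup: "is_sup_on sa_part y z s"
  obtains r where "central_projection r" "op_le (r * y) (r * z)" "op_le ((1 - r) * z) ((1 - r) * y)"
proof -
  define a where "a = s - z"
  define b where "b = s - y"
  have pos: "positive_el a" "positive_el b" using sup by (auto simp: is_sup_on_def op_le_def a_def b_def)
  have s: "adj s = s" using sup by (simp add: is_sup_on_def sa_part_def self_adjoint_def)
  have "op_le w 0" if "adj w = w" "op_le w a" "op_le w b" for w
  proof -
    have "op_le y (s - w)" "op_le z (s - w)" "s - w \<in> sa_part"
      using that s by (auto simp: op_le_def a_def b_def algebra_simps sa_part_def self_adjoint_def)
    then have "op_le s (s - w)" using sup by (auto simp: is_sup_on_def)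
    then show ?thesis by (simp add: op_le_def)
  qed
  then have axb: "a * x * b = 0" for x using inf_0_imp_mult_0[OF pos] by blast
  have "range ((*) a) \<noteq> {}" by blast
  moreover have "f * (x * c) = 0" if fr: "f \<in> range ((*) a)" and fc: "\<forall>g\<in>range ((*) a). g * c = 0" for f x c
  proof -
    obtain v where "f = a * v" using fr by blast
    moreover have "(a * (v * x)) * c = 0" using fc by blast
    ultimately show ?thesis by (simp add: mult.assoc)
  qed
  ultimately obtain r where r: "central_projection r" "\<forall>c. (\<forall>f\<in>range ((*) a). f * c = 0) \<longleftrightarrow> r * c = c"
    by (rule annihilator_central[OF AW])
  have rb: "r * b = b" using r(2)[rule_format, of b] axb by auto
  have "a * 1 * r = 0" using r(2)[rule_format, of r] central_projection_idem[OF r(1)] by blast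
  then have ra: "r * a = 0" using central_projection_commute[OF r(1)] by simp
  have "r * z - r * y = b" using ra rb by (simp add: a_def b_def algebra_simps)
  moreover have "(1 - r) * y - (1 - r) * z = a" using ra rb by (simp add: a_def b_def algebra_simps)
  ultimately show thesis using that[OF r(1)] pos by (simp add: op_le_def)
qed

text \<open>Bisection: comparing \<open>y\<close> with the central element \<open>k + t/2\<close> halves the length \<open>t\<close> of the
  order interval \<open>[k, k + t]\<close> containing \<open>y\<close>.\<close>

lemma sup_imp_central:
  fixes y :: "'a::cstar_algebra"
  assumes AW: "AW_algebra TYPE('a)" and y: "positive_el y"
    and sup: "\<And>z. positive_el z \<Longrightarrow> \<exists>s. is_sup_on sa_part y z s"
  shows "is_central y"
proof -
  have approx: "\<exists>k. is_central k \<and> positive_el k \<and> op_le k y \<and> op_le y (k + (norm y / 2 ^ n) *\<^sub>R 1)" for n :: nat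
  proof (induction n)
    case 0
    show ?case using y positive_norm_diff[of y "norm y"] positive_adj[OF y]
      by (intro exI[of _ 0]) (simp add: is_central_def op_le_def)
  next
    case (Suc n)
    then obtain k where k: "is_central k" "positive_el k" "op_le k y" "op_le y (k + (norm y / 2 ^ n) *\<^sub>R 1)"
      by blast
    define t where "t = norm y / 2 ^ Suc n"
    have "t \<ge> 0" by (simp add: t_def)
    have tt: "norm y / 2 ^ n = t + t" by (simp add: t_def)
    define z where "z = k + t *\<^sub>R 1"
    have "positive_el z" unfolding z_def using k(2) positive_scalar[OF \<open>t \<ge> 0\<close>] by (rule positive_add)
    then obtain s where "is_sup_on sa_part y z s" using sup by blast
    then obtain r where r: "central_projection r" "op_le (r * y) (r * z)" "op_le ((1 - r) * z) ((1 - r) * y)"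
      using sup_central_comparison[OF AW positive_adj[OF y] positive_adj[OF \<open>positive_el z\<close>]] by blast
    note r' = central_projection_perp[OF r(1)]
    \<comment> \<open>By the comparison, \<open>y\<close> lies in the lower half
      \<open>[k, k + t]\<close> on \<open>r\<close> and in the upper half on \<open>1 - r\<close>;
      the lower end is raised only on the latter.\<close>
    define k' where "k' = k + t *\<^sub>R (1 - r)"
    have rk: "r * k' = r * k" "(1 - r) * k' = (1 - r) * z"
      using r(1) r' by (simp_all add: k'_def z_def distrib_left central_projection_idem)
        (simp add: algebra_simps central_projection_idem)
    have "op_le k' y"
      by (rule op_le_split[of r]) (simp_all add: rk r(3) op_le_central_mult[OF r(1) k(3)])
    moreover have "op_le y (k' + t *\<^sub>R 1)"
    proof (rule op_le_split[of r])
      have "r * (k' + t *\<^sub>R 1) = r * z" by (simp add: distrib_left rk z_def)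
      then show "op_le (r * y) (r * (k' + t *\<^sub>R 1))" using r(2) by simp
      have "(1 - r) * (k' + t *\<^sub>R 1) = (1 - r) * (k + (norm y / 2 ^ n) *\<^sub>R 1)"
        unfolding tt by (simp only: distrib_left rk z_def scaleR_add_left add.assoc)
      then show "op_le ((1 - r) * y) ((1 - r) * (k' + t *\<^sub>R 1))"
        using op_le_central_mult[OF r' k(4)] by simp
    qed
    moreover have "is_central k'"
      using k(1) central_projection_commute[OF r'] unfolding k'_def is_central_def
      by (simp only: distrib_left distrib_right mult_scaleR_left mult_scaleR_right) metis
    moreover have "positive_el k'"
      using k(2) positive_square[of "1 - r"] r' \<open>t \<ge> 0\<close> unfolding k'_def
      by (intro positive_add positive_scaleR) (simp_all add: central_projection_idem central_projection_adj del: adj_diff)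
    ultimately show ?case unfolding t_def by blast
  qed
  have "y * x - x * y = 0" for x
  proof -
    have "norm (y * x - x * y) \<le> 2 * norm y * norm x * (1/2) ^ n" for n
    proof -
      obtain k where k: "is_central k" "op_le k y" "op_le y (k + (norm y / 2 ^ n) *\<^sub>R 1)" using approx by blast
      then have n: "norm (y - k) \<le> norm y / 2 ^ n"
        by (intro norm_le_of_between) (auto simp: op_le_def algebra_simps)
      \<comment> \<open>Central elements drop out of commutators, so only the error
        \<open>y - k\<close> counts.\<close>
      have "y * x - x * y = (y - k) * x - x * (y - k)" using k(1) by (simp add: is_central_def algebra_simps)
      also have "norm \<dots> \<le> norm (y - k) * norm x + norm x * norm (y - k)"
        by (intro order_trans[OF norm_triangle_ineq4] add_mono norm_mult_ineq)
      also have "\<dots> \<le> 2 * ((norm y / 2 ^ n) * norm x)"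
        using mult_right_mono[OF n norm_ge_zero[of x]] by (simp add: mult.commute)
      finally show ?thesis by (simp add: power_one_over)
    qed
    moreover have "(\<lambda>n. 2 * norm y * norm x * (1/2) ^ n) \<longlonglongrightarrow> 2 * norm y * norm x * 0"
      by (intro tendsto_intros LIMSEQ_power_zero) simp
    ultimately have "norm (y * x - x * y) \<le> 2 * norm y * norm x * 0"
      by (intro LIMSEQ_le_const) auto
    then show ?thesis by simp
  qed
  then show ?thesis by (simp add: is_central_def)
qed

text \<open>For \<open>0 \<le> x \<le> 1\<close> one has \<open>y x y \<le> y^2 \<le> N y\<close>,
  so a multiple of \<open>y x y = y^2 x\<close> lies below \<open>y\<close> and is central. Hence
  \<open>y^2 x\<close> is central for all \<open>x\<close>, and \<open>y^2\<close> kills all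
  commutators; then so does \<open>y\<close>.\<close>

lemma hereditary_central_imp_pA1:
  fixes y :: "'a::cstar_algebra"
  assumes AW: "AW_algebra TYPE('a)" and y: "positive_el y"
    and central: "\<And>y'. positive_el y' \<Longrightarrow> op_le y' y \<Longrightarrow> is_central y'"
  shows "pA1 TYPE('a) * y = y"
proof -
  have yc: "y * x = x * y" for x using central[OF y] by (simp add: is_central_def)
  define N where "N = norm y + 1"
  have "N > 0" unfolding N_def by (smt (verit) norm_ge_zero)
  have unit: "y * x * y * u = u * (y * x * y)" if x: "positive_el x" "op_le x 1" for x u
  proof -
    have "positive_el (adj y * x * y)" by (rule positive_conj[OF x(1)])
    then have p: "positive_el (y * x * y)" using positive_adj[OF y] by simp
    have "positive_el (adj y * (1 - x) * y)" using x(2) by (intro positive_conj) (simp add: op_le_def)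
    then have "positive_el (y * y - y * x * y)" using positive_adj[OF y] by (simp add: algebra_simps)
    moreover have "positive_el (N *\<^sub>R y - y * y)" by (rule positive_diff_square[OF y]) (simp add: N_def)
    ultimately have "positive_el (N *\<^sub>R y - y * x * y)" using positive_add by fastforce
    from positive_scaleR[OF this, of "1/N"] have "op_le ((1/N) *\<^sub>R (y * x * y)) y"
      using \<open>N > 0\<close> by (simp add: op_le_def scaleR_diff_right)
    then have "is_central ((1/N) *\<^sub>R (y * x * y))"
      using p \<open>N > 0\<close> by (intro central positive_scaleR) auto
    then show ?thesis using \<open>N > 0\<close> by (simp add: is_central_def)
  qed
  have sa: "y * y * h * u = u * (y * y * h)" if h: "adj h = h" for h u
  proof -
    define M where "M = norm h + 1"
    have "M > 0" unfolding M_def by (smt (verit) norm_ge_zero)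
    \<comment> \<open>Moves \<open>h\<close> into the unit interval, where \<open>unit\<close>
      applies.\<close>
    define x where "x = (1 / (2 * M)) *\<^sub>R (M *\<^sub>R 1 + h)"
    have "positive_el (M *\<^sub>R 1 - (- h))" "positive_el (M *\<^sub>R 1 - h)"
      by (rule positive_norm_diff; simp add: h M_def)+
    then have "positive_el x" "positive_el ((1 / (2 * M)) *\<^sub>R (M *\<^sub>R 1 - h))"
      using \<open>M > 0\<close> by (auto simp: x_def intro!: positive_scaleR)
    moreover have "(1 / (2 * M)) *\<^sub>R (M *\<^sub>R 1 - h) = 1 - x"
    proof -
      have "(M *\<^sub>R 1 - h) + (M *\<^sub>R 1 + h) = (2 * M) *\<^sub>R 1" by (simp only: mult_2 scaleR_add_left) simp
      then have "(1 / (2 * M)) *\<^sub>R (M *\<^sub>R 1 - h) + x = (1 / (2 * M)) *\<^sub>R (2 * M) *\<^sub>R 1"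
        by (simp only: x_def flip: scaleR_add_right)
      also have "\<dots> = 1" using \<open>M > 0\<close> by simp
      finally show ?thesis by (simp add: algebra_simps)
    qed
    ultimately have "y * x * y * u = u * (y * x * y)" by (intro unit) (auto simp: op_le_def)
    moreover have "y * x * y = y * y * x" by (simp only: mult.assoc yc[of x, symmetric])
    ultimately have xu: "y * y * x * u = u * (y * y * x)" by simp
    have hx: "h = (2 * M) *\<^sub>R x - M *\<^sub>R 1" using \<open>M > 0\<close> by (simp add: x_def)
    have "y * y * u = u * (y * y)" using yc by (metis mult.assoc)
    with xu show ?thesis unfolding hx by (simp add: algebra_simps)
  qed
  have all: "y * y * x * u = u * (y * y * x)" for x u
  proof -
    obtain h k :: 'a where hk: "adj h = h" "adj k = k" "x = h + scaleC \<i> k"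
      by (rule cartesian_decomposition)
    then show ?thesis using sa[OF hk(1), of u] sa[OF hk(2), of u] by (simp add: distrib_left distrib_right)
  qed
  have "(u * v - v * u) * y = 0" for u v
  proof -
    define c where "c = u * v - v * u"
    have "y * y * v * u = v * (y * y * u)"
      using all[of 1 v] by (simp flip: mult.assoc)
    \<comment> \<open>Centrality of \<open>y^2 u\<close> and of \<open>y^2\<close> gives
      \<open>y^2 u v = v y^2 u = y^2 v u\<close>.\<close>
    then have "y * y * c = 0"
      using all[of u v] by (simp add: c_def algebra_simps)
    moreover have "adj (c * y) = adj c * y" using yc[of "adj c"] positive_adj[OF y] by simp
    then have "adj (c * y) * (c * y) = adj c * (y * y * c)" using yc[of c] by (simp add: mult.assoc)
    ultimately have "adj (c * y) * (c * y) = 0" by simp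
    then have "c * y = 0" unfolding adj_mult_self_eq_0 .
    then show ?thesis unfolding c_def .
  qed
  then show ?thesis using pA1_properties(2)[OF AW, of y] by blast
qed

section \<open>The commutative part of an operator interval\<close>

text \<open>Collects what is used of operator intervals, so that their kinds can be treated
  together. The last clause gives two elements a common lower bound with a whole scalar step above
  it inside \<open>I\<close>; there suprema in \<open>I\<close> can be compared with suprema in
  \<open>sa_part\<close>.\<close>

definition admissible :: "'a::cstar_algebra set \<Rightarrow> bool" where
  "admissible I \<longleftrightarrow> I \<subseteq> sa_part
     \<and> (\<forall>a\<in>I. \<forall>b\<in>I. \<forall>c. op_le a c \<longrightarrow> op_le c b \<longrightarrow> c \<in> I)
     \<and> (\<forall>a\<in>I. \<forall>b\<in>I. \<forall>r. central_projection r \<longrightarrow> r * a + (1 - r) * b \<in> I)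
     \<and> (\<forall>a\<in>I. \<forall>b\<in>I. \<exists>c\<in>I. \<exists>d>0. op_le c a \<and> op_le c b \<and> c + d *\<^sub>R 1 \<in> I)"

lemma admissible_adj: "admissible I \<Longrightarrow> a \<in> I \<Longrightarrow> adj a = a"
  by (auto simp: admissible_def sa_part_def self_adjoint_def)

lemma admissible_convex: "admissible I \<Longrightarrow> a \<in> I \<Longrightarrow> b \<in> I \<Longrightarrow> op_le a c \<Longrightarrow> op_le c b \<Longrightarrow> c \<in> I"
  unfolding admissible_def by blast

lemma admissible_mix: "admissible I \<Longrightarrow> a \<in> I \<Longrightarrow> b \<in> I \<Longrightarrow> central_projection r \<Longrightarrow> r * a + (1 - r) * b \<in> I"
  unfolding admissible_def by blast

lemma admissible_room:
  assumes "admissible I" "a \<in> I" "b \<in> I"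
  obtains c d where "c \<in> I" "d > 0" "op_le c a" "op_le c b" "c + d *\<^sub>R 1 \<in> I"
  using assms unfolding admissible_def by blast

section \<open>Bounds and central mixtures\<close>

lemma op_le_norm:
  assumes "adj a = a" "norm a \<le> s"
  shows "op_le a (s *\<^sub>R 1)" "op_le (- (s *\<^sub>R 1)) a"
  using positive_norm_diff[of a s] positive_norm_diff[of "- a" s] assms
  by (simp_all add: op_le_def add.commute)

lemma op_le_mix_lower:
  assumes "central_projection r" "op_le x a" "op_le x b"
  shows "op_le x (r * a + (1 - r) * b)"
  by (rule op_le_split[of r])
    (simp_all add: distrib_left central_projection_simps assms op_le_central_mult central_projection_perp)

lemma op_le_mix_upper:
  assumes "central_projection r" "op_le a x" "op_le b x"
  shows "op_le (r * a + (1 - r) * b) x"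
  by (rule op_le_split[of r])
    (simp_all add: distrib_left central_projection_simps assms op_le_central_mult central_projection_perp)

lemma op_le_shift_mono: "d \<le> e \<Longrightarrow> op_le (a + d *\<^sub>R 1) (a + e *\<^sub>R 1)"
  using positive_scalar[of "e - d"] by (simp add: op_le_def scaleR_diff_left)

lemma op_lt_both:
  assumes "op_lt x a" "op_lt x b"
  obtains d where "d > 0" "op_le (x + d *\<^sub>R 1) a" "op_le (x + d *\<^sub>R 1) b"
proof -
  obtain d e where de: "d > 0" "e > 0" "op_le (x + d *\<^sub>R 1) a" "op_le (x + e *\<^sub>R 1) b"
    using assms unfolding op_lt_iff by blast
  show thesis
  proof (rule that[of "min d e"])
    show "op_le (x + min d e *\<^sub>R 1) a" by (rule op_le_trans[OF op_le_shift_mono de(3)]) simp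
    show "op_le (x + min d e *\<^sub>R 1) b" by (rule op_le_trans[OF op_le_shift_mono de(4)]) simp
  qed (use de in auto)
qed

lemma op_lt_iff_upper: "op_lt a b \<longleftrightarrow> (\<exists>d>0. op_le a (b - d *\<^sub>R 1))"
  by (simp add: op_lt_iff op_le_def algebra_simps)

lemma op_lt_mix_lower:
  assumes "central_projection r" "op_lt x a" "op_lt x b"
  shows "op_lt x (r * a + (1 - r) * b)"
  using op_lt_both[OF assms(2,3)] op_le_mix_lower[OF assms(1)] unfolding op_lt_iff by metis

lemma op_lt_neg: "op_lt (- a) (- b) \<longleftrightarrow> op_lt b a"
  by (simp add: op_lt_def)

lemma op_lt_mix_upper:
  assumes "central_projection r" "op_lt a x" "op_lt b x"
  shows "op_lt (r * a + (1 - r) * b) x"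
proof -
  have "op_lt (- x) (r * (- a) + (1 - r) * (- b))"
    using assms by (intro op_lt_mix_lower) (simp_all add: op_lt_neg)
  also have "r * (- a) + (1 - r) * (- b) = - (r * a + (1 - r) * b)" by simp
  finally show ?thesis by (simp only: op_lt_neg)
qed

lemma op_lt_le_trans: "op_lt a b \<Longrightarrow> op_le b c \<Longrightarrow> op_lt a c"
  unfolding op_lt_iff using op_le_trans by blast

lemma op_le_lt_trans: "op_le a b \<Longrightarrow> op_lt b c \<Longrightarrow> op_lt a c"
  unfolding op_lt_iff_upper using op_le_trans by blast

lemma sa_shift: "a \<in> sa_part \<Longrightarrow> a + d *\<^sub>R 1 \<in> sa_part"
  by (simp add: sa_part_def self_adjoint_def)

lemma sa_mix: "a \<in> sa_part \<Longrightarrow> b \<in> sa_part \<Longrightarrow> central_projection r \<Longrightarrow> r * a + (1 - r) * b \<in> sa_part"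
  using central_projection_commute[of r a] central_projection_commute[of "1 - r" b]
  by (simp add: sa_part_def self_adjoint_def central_projection_adj central_projection_perp del: adj_diff)

lemma sa_lower:
  assumes "a \<in> sa_part" "b \<in> sa_part"
  obtains c d where "c \<in> sa_part" "d > (0::real)" "op_le (c + d *\<^sub>R 1) a" "op_le (c + d *\<^sub>R 1) b"
proof -
  define N where "N = max (norm a) (norm b)"
  have "op_le (- (N *\<^sub>R 1)) a" "op_le (- (N *\<^sub>R 1)) b"
    using assms by (auto simp: N_def sa_part_def self_adjoint_def intro!: op_le_norm)
  then show thesis
    using that[of "- ((N + 1) *\<^sub>R 1)" 1] by (simp add: sa_part_def self_adjoint_def scaleR_add_left)
qed

text \<open>Operator intervals are cut out by a lower condition, an up-set \<open>L\<close>, and an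
  upper one, a down-set \<open>U\<close>. The scalar room is left as a premise, since it depends on
  the kind of the ends.\<close>

lemma admissible_bounds:
  fixes L U :: "'a::cstar_algebra \<Rightarrow> bool"
  assumes up: "\<And>a b. L a \<Longrightarrow> op_le a b \<Longrightarrow> L b"
    and down: "\<And>a b. U b \<Longrightarrow> op_le a b \<Longrightarrow> U a"
    and mix: "\<And>a b r. central_projection r \<Longrightarrow> L a \<Longrightarrow> L b \<Longrightarrow> L (r * a + (1 - r) * b)"
      "\<And>a b r. central_projection r \<Longrightarrow> U a \<Longrightarrow> U b \<Longrightarrow> U (r * a + (1 - r) * b)"
    and room: "\<And>a b. a \<in> sa_part \<Longrightarrow> b \<in> sa_part \<Longrightarrow> L a \<Longrightarrow> L b \<Longrightarrow> U a \<Longrightarrow> U b \<Longrightarrow>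
      \<exists>c\<in>sa_part. \<exists>d>0. L c \<and> op_le c a \<and> op_le c b \<and> U (c + d *\<^sub>R 1)"
  shows "admissible {c \<in> sa_part. L c \<and> U c}" (is "admissible ?I")
  unfolding admissible_def
proof (intro conjI ballI allI impI)
  show "?I \<subseteq> sa_part" by blast
next
  fix a b c assume "a \<in> ?I" "b \<in> ?I" "op_le a c" "op_le c b"
  moreover have "adj (c - a) = c - a" using \<open>op_le a c\<close> unfolding op_le_def by (rule positive_adj)
  ultimately show "c \<in> ?I" using up down by (auto simp: sa_part_def self_adjoint_def)
next
  fix a b r :: 'a assume "a \<in> ?I" "b \<in> ?I" "central_projection r"
  then show "r * a + (1 - r) * b \<in> ?I" using mix sa_mix by blast
next
  fix a b assume ab: "a \<in> ?I" "b \<in> ?I"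
  then obtain c d where c: "c \<in> sa_part" "d > 0" "L c" "op_le c a" "op_le c b" "U (c + d *\<^sub>R 1)"
    using room[of a b] by blast
  have "op_le c (c + d *\<^sub>R 1)" using positive_scalar[of d] c(2) by (simp add: op_le_def)
  then have "c \<in> ?I" "c + d *\<^sub>R 1 \<in> ?I" using c up[of c] down[of "c + d *\<^sub>R 1"] sa_shift by blast+
  then show "\<exists>c\<in>?I. \<exists>d>0. op_le c a \<and> op_le c b \<and> c + d *\<^sub>R 1 \<in> ?I" using c by blast
qed

text \<open>With no lower end or an open one there is room below any two members, and the upper
  condition is inherited from them. With a closed lower end, that end itself serves as lower bound;
  the room above it comes from \<open>op_lt a b\<close>, or from the absence of an upper
  end.\<close>

lemma operator_interval_admissible:
  fixes I :: "'a::cstar_algebra set"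
  assumes "operator_interval I"
  shows "admissible I"
proof -
  \<comment> \<open>The constant predicate stands for a missing end; closed lower ends are treated
    separately in \<open>closed_below\<close>.\<close>
  define lower :: "('a \<Rightarrow> bool) set" where "lower = {\<lambda>_. True} \<union> {op_lt x | x. x \<in> sa_part}"
  define upper :: "('a \<Rightarrow> bool) set" where
    "upper = {\<lambda>_. True} \<union> {\<lambda>c. op_le c y | y. y \<in> sa_part} \<union> {\<lambda>c. op_lt c y | y. y \<in> sa_part}"
  have U: "U b \<Longrightarrow> op_le a b \<Longrightarrow> U a" "central_projection r \<Longrightarrow> U a \<Longrightarrow> U b \<Longrightarrow> U (r * a + (1 - r) * b)"
    if "U \<in> upper" for U a b r
    using that op_le_trans op_le_lt_trans op_le_mix_upper op_lt_mix_upper unfolding upper_def by blast+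
  have open_below: "admissible {c \<in> sa_part. L c \<and> U c}" if L: "L \<in> lower" and U': "U \<in> upper" for L U
  proof (rule admissible_bounds)
    show "L b" if "L a" "op_le a b" for a b
      using L that op_lt_le_trans unfolding lower_def by blast
    show "L (r * a + (1 - r) * b)" if "central_projection r" "L a" "L b" for a b r
      using L that op_lt_mix_lower unfolding lower_def by blast
    fix a b assume ab: "a \<in> sa_part" "b \<in> sa_part" "L a" "L b" "U a" "U b"
    have "\<exists>c\<in>sa_part. \<exists>d>0. L c \<and> op_le (c + d *\<^sub>R 1) a \<and> op_le (c + d *\<^sub>R 1) b"
    proof (cases "L = (\<lambda>_. True)")
      case True
      then show ?thesis using sa_lower[OF ab(1,2)] by metis
    next
      case False
      then obtain x where x: "x \<in> sa_part" "L = op_lt x" using L by (auto simp: lower_def)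
      then obtain d where d: "d > 0" "op_le (x + d *\<^sub>R 1) a" "op_le (x + d *\<^sub>R 1) b"
        using ab op_lt_both by metis
      \<comment> \<open>Half of the gap keeps the new element strictly above \<open>x\<close>, the
        other half is the room below \<open>a\<close> and \<open>b\<close>.\<close>
      have "op_lt x (x + (d/2) *\<^sub>R 1)" unfolding op_lt_iff using d(1) by (intro exI[of _ "d/2"]) simp
      moreover have eq: "x + (d/2) *\<^sub>R 1 + (d/2) *\<^sub>R 1 = x + d *\<^sub>R 1"
        by (simp only: add.assoc flip: scaleR_add_left) simp
      ultimately show ?thesis using d x sa_shift[OF x(1), of "d/2"]
        by (intro bexI[of _ "x + (d/2) *\<^sub>R 1"] exI[of _ "d/2"]) (auto simp: eq)
    qed
    then obtain c d where c: "c \<in> sa_part" "d > 0" "L c" "op_le (c + d *\<^sub>R 1) a" "op_le (c + d *\<^sub>R 1) b"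
      by blast
    have cd: "op_le c (c + d *\<^sub>R 1)" using positive_scalar[of d] c(2) by (simp add: op_le_def)
    show "\<exists>c\<in>sa_part. \<exists>d>0. L c \<and> op_le c a \<and> op_le c b \<and> U (c + d *\<^sub>R 1)"
      using c op_le_trans[OF cd c(4)] op_le_trans[OF cd c(5)] U(1)[OF U' ab(5) c(4)] by blast
  qed (use U[OF U'] in blast)+
  have closed_below: "admissible {c \<in> sa_part. op_le x c \<and> U c}"
    if U': "U \<in> upper" and x: "x \<in> sa_part" and d: "d > 0" "U (x + d *\<^sub>R 1)" for x U and d :: real
  proof (rule admissible_bounds)
    fix a b assume "op_le x a" "op_le x b"
    then show "\<exists>c\<in>sa_part. \<exists>d>0. op_le x c \<and> op_le c a \<and> op_le c b \<and> U (c + d *\<^sub>R 1)"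
      using x d by (intro bexI[of _ x] exI[of _ d]) auto
  qed (use U[OF U'] op_le_trans op_le_mix_lower in blast)+
  have lower: "(\<lambda>_. True) \<in> lower" "\<And>x. x \<in> sa_part \<Longrightarrow> op_lt x \<in> lower" by (auto simp: lower_def)
  have upper: "(\<lambda>_. True) \<in> upper" "\<And>y. y \<in> sa_part \<Longrightarrow> (\<lambda>c. op_le c y) \<in> upper"
    "\<And>y. y \<in> sa_part \<Longrightarrow> (\<lambda>c. op_lt c y) \<in> upper" by (auto simp: upper_def)
  have between: "admissible {c \<in> sa_part. op_le a c \<and> op_le c b}" "admissible {c \<in> sa_part. op_le a c \<and> op_lt c b}"
    if "a \<in> sa_part" "b \<in> sa_part" and ab: "op_lt a b" for a b :: 'a
  proof -
    obtain d where d: "d > 0" "op_le (a + d *\<^sub>R 1) b" using ab unfolding op_lt_iff by blast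
    have eq: "a + (d/2) *\<^sub>R 1 + (d/2) *\<^sub>R 1 = a + d *\<^sub>R 1"
      by (simp only: add.assoc flip: scaleR_add_left) simp
    \<comment> \<open>Only half of the gap is used, so that the shifted lower end stays strictly
      below \<open>b\<close>.\<close>
    have "op_lt (a + (d/2) *\<^sub>R 1) b" unfolding op_lt_iff using d by (intro exI[of _ "d/2"]) (simp add: eq)
    then show "admissible {c \<in> sa_part. op_le a c \<and> op_lt c b}"
      using closed_below[OF upper(3)[OF that(2)] that(1), of "d/2"] d by simp
    show "admissible {c \<in> sa_part. op_le a c \<and> op_le c b}"
      using closed_below[OF upper(2)[OF that(2)] that(1), of d] d by simp
  qed
  have "admissible (sa_part :: 'a set)" using open_below[OF lower(1) upper(1)] by simp
  moreover have "admissible {c \<in> sa_part. op_le a c}" if "a \<in> sa_part" for a :: 'a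
    using closed_below[OF upper(1) that, of 1] by simp
  moreover have "admissible {c \<in> sa_part. op_le c a}" "admissible {c \<in> sa_part. op_lt a c}"
    "admissible {c \<in> sa_part. op_lt c a}" if "a \<in> sa_part" for a :: 'a
    using open_below[OF lower(1) upper(2)[OF that]] open_below[OF lower(2)[OF that] upper(1)]
      open_below[OF lower(1) upper(3)[OF that]] by simp_all
  moreover have "admissible {c \<in> sa_part. op_lt a c \<and> op_le c b}" "admissible {c \<in> sa_part. op_lt a c \<and> op_lt c b}"
    if "a \<in> sa_part" "b \<in> sa_part" for a b :: 'a
    using open_below[OF lower(2) upper(2)] open_below[OF lower(2) upper(3)] that by simp_all
  ultimately show ?thesis using assms between unfolding operator_interval_def by (elim disjE bexE conjE) simp_all
qed

text \<open>On the boundary of \<open>I\<close> the condition \<open>sup_above\<close> is too weak: in the unit interval of a \<open>2 \<times> 2\<close>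
  matrix algebra, the elements above a rank-one projection form a chain. This is why
  \<open>commutative_le\<close> transports the condition to all \<open>c\<close> below \<open>a\<close>.\<close>

definition sup_above :: "'a::cstar_algebra set \<Rightarrow> 'a \<Rightarrow> 'a \<Rightarrow> bool" where
  "sup_above I c d \<longleftrightarrow> d \<in> I \<and> op_le c d
     \<and> (\<forall>d'\<in>I. op_le c d' \<longrightarrow> op_le d' d \<longrightarrow> (\<forall>e\<in>I. op_le c e \<longrightarrow> (\<exists>s. is_sup_on I d' e s)))"

definition commutative_le :: "'a::cstar_algebra set \<Rightarrow> 'a \<Rightarrow> 'a \<Rightarrow> bool" where
  "commutative_le I a b \<longleftrightarrow> op_le a b \<and> (\<forall>c\<in>I. op_le c a \<longrightarrow> (\<exists>d. sup_above I c d \<and> is_sup_on I a d b))"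

text \<open>The order-theoretic form of \<open>p * a = p * b\<close> for comparable elements, see
  \<open>noncommutative_le_iff\<close>.\<close>

definition noncommutative_le :: "'a::cstar_algebra set \<Rightarrow> 'a \<Rightarrow> 'a \<Rightarrow> bool" where
  "noncommutative_le I a b \<longleftrightarrow> op_le a b
     \<and> (\<forall>c\<in>I. op_le a c \<longrightarrow> op_le c b \<longrightarrow> commutative_le I a c \<longrightarrow> c = a)"

text \<open>After translation by \<open>c\<close>, an upper bound \<open>u\<close> of
  \<open>y\<close> and \<open>z\<close> may leave the interval, but \<open>(1 - t) S + t u\<close>
  with small \<open>t\<close> does not. It is an upper bound too, so it dominates \<open>S\<close>,
  which means \<open>t (u - S) \<ge> 0\<close>.\<close>

lemma is_sup_on_imp_sup_sa:
  fixes y z :: "'a::cstar_algebra"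
  assumes I: "admissible I" "c \<in> I" "c + e *\<^sub>R 1 \<in> I" "e > 0"
    and yz: "positive_el y" "positive_el z" "op_le y ((e/4) *\<^sub>R 1)" "op_le z ((e/4) *\<^sub>R 1)"
    and sup: "is_sup_on I (c + y) (c + z) s"
  shows "is_sup_on sa_part y z (s - c)"
proof -
  have mem: "c + v \<in> I" if "positive_el v" "op_le v (e *\<^sub>R 1)" for v
    using that by (intro admissible_convex[OF I(1-3)]) (simp_all add: op_le_def)
  define S where "S = s - c"
  have S: "op_le y S" "op_le z S" using sup by (auto simp: is_sup_on_def op_le_def S_def algebra_simps)
  have half: "(e/4) *\<^sub>R 1 + (e/4) *\<^sub>R 1 = (e/2) *\<^sub>R (1::'a)" by (simp flip: scaleR_add_left)
  have yz2: "op_le (y + z) ((e/2) *\<^sub>R 1)" using op_le_add[OF yz(3,4)] unfolding half .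
  have halfle: "op_le ((e/2) *\<^sub>R 1) (e *\<^sub>R (1::'a))" using op_le_shift_mono[of "e/2" e 0] I(4) by simp
  \<comment> \<open>The upper bound \<open>y + z\<close> keeps \<open>S\<close> below
    \<open>e/2\<close>; hence the bounds \<open>e/4\<close> on \<open>y\<close> and
    \<open>z\<close>.\<close>
  have "c + (y + z) \<in> I" using op_le_trans[OF yz2 halfle] yz by (intro mem positive_add)
  then have "op_le s (c + (y + z))" using sup yz by (auto simp: is_sup_on_def op_le_def)
  then have "op_le S (y + z)" by (simp add: op_le_def S_def algebra_simps)
  then have S2: "op_le S ((e/2) *\<^sub>R 1)" using yz2 op_le_trans by blast
  have Ssa: "adj S = S" using sup I(2) admissible_adj[OF I(1)] by (simp add: is_sup_on_def S_def)
  have "op_le S u" if u: "adj u = u" "op_le y u" "op_le z u" for u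
  proof -
    \<comment> \<open>Chosen so that \<open>t u \<le> e/2\<close>; together with
      \<open>(1 - t) S \<le> e/2\<close> the mixture stays below \<open>e\<close>.\<close>
    define t where "t = min 1 ((e/2) / (norm u + 1))"
    have "norm u + 1 > 0" by (smt (verit) norm_ge_zero)
    then have t: "0 < t" "t \<le> 1" using I(4) by (auto simp: t_def)
    have "t * norm u \<le> ((e/2) / (norm u + 1)) * norm u" by (intro mult_right_mono) (auto simp: t_def)
    also have "\<dots> \<le> e/2" using \<open>norm u + 1 > 0\<close> I(4) by (simp add: divide_simps)
    finally have "op_le (t *\<^sub>R u) ((e/2) *\<^sub>R 1)" using u t by (intro op_le_norm) auto
    moreover have "op_le ((1 - t) *\<^sub>R S) ((e/2) *\<^sub>R 1)"
    proof -
      have "op_le ((1 - t) *\<^sub>R S) ((1 - t) *\<^sub>R ((e/2) *\<^sub>R 1))" using S2 t by (intro op_le_scaleR) auto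
      moreover have "op_le ((1 - t) *\<^sub>R ((e/2) *\<^sub>R (1::'a))) ((e/2) *\<^sub>R 1)"
        using op_le_shift_mono[of "(1 - t) * (e/2)" "e/2" "0::'a"] t I(4) by (simp add: algebra_simps)
      ultimately show ?thesis by (rule op_le_trans)
    qed
    ultimately have "op_le ((1 - t) *\<^sub>R S + t *\<^sub>R u) ((e/2) *\<^sub>R 1 + (e/2) *\<^sub>R 1)"
      by (intro op_le_add)
    moreover have "(e/2) *\<^sub>R 1 + (e/2) *\<^sub>R 1 = e *\<^sub>R (1::'a)" by (simp flip: scaleR_add_left)
    ultimately have le: "op_le ((1 - t) *\<^sub>R S + t *\<^sub>R u) (e *\<^sub>R 1)" by simp
    have ge: "op_le v ((1 - t) *\<^sub>R S + t *\<^sub>R u)" if "op_le v S" "op_le v u" for v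
    proof -
      have "op_le ((1 - t) *\<^sub>R v + t *\<^sub>R v) ((1 - t) *\<^sub>R S + t *\<^sub>R u)"
        using that t by (intro op_le_add op_le_scaleR) auto
      then show ?thesis by (simp flip: scaleR_add_left)
    qed
    have "op_le 0 ((1 - t) *\<^sub>R S + t *\<^sub>R u)"
      using ge[OF S(1) u(2)] yz(1) op_le_trans[of 0 y] by (simp add: op_le_def)
    then have "c + ((1 - t) *\<^sub>R S + t *\<^sub>R u) \<in> I" using le by (intro mem) (simp_all add: op_le_def)
    then have "op_le s (c + ((1 - t) *\<^sub>R S + t *\<^sub>R u))"
      using sup ge[OF S(1) u(2)] ge[OF S(2) u(3)] by (simp add: is_sup_on_def)
    then have "positive_el (t *\<^sub>R (u - S))" by (simp add: op_le_def S_def algebra_simps)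
    from positive_scaleR[OF this, of "1/t"] show ?thesis using t by (simp add: op_le_def)
  qed
  then show ?thesis
    using S Ssa by (auto simp: is_sup_on_def sa_part_def self_adjoint_def S_def)
qed

lemma is_sup_on_sa_scaleR:
  assumes "is_sup_on sa_part (t *\<^sub>R y) (t *\<^sub>R z) s" "t > 0"
  shows "is_sup_on sa_part y z ((1/t) *\<^sub>R s)"
proof -
  have iff: "op_le a ((1/t) *\<^sub>R b) \<longleftrightarrow> op_le (t *\<^sub>R a) b" "op_le ((1/t) *\<^sub>R b) a \<longleftrightarrow> op_le b (t *\<^sub>R a)" for a b :: 'a
    using op_le_scaleR[of a "(1/t) *\<^sub>R b" t] op_le_scaleR[of "t *\<^sub>R a" b "1/t"]
      op_le_scaleR[of "(1/t) *\<^sub>R b" a t] op_le_scaleR[of b "t *\<^sub>R a" "1/t"] assms(2) by auto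
  show ?thesis
    using assms by (auto simp: is_sup_on_def iff sa_part_def self_adjoint_def op_le_scaleR less_imp_le)
qed

text \<open>An element \<open>y\<close> of \<open>[0, d - c]\<close> and any
  \<open>z \<ge> 0\<close> are shrunk until they fit into the room above \<open>c\<close>. The
  supremum granted by \<open>sup_above\<close> is then one in \<open>sa_part\<close> and scales
  back, so \<open>y\<close> is central by \<open>sup_imp_central\<close>.\<close>

lemma sup_above_imp_pA1:
  fixes I :: "'a::cstar_algebra set"
  assumes AW: "AW_algebra TYPE('a)" and I: "admissible I" "c \<in> I" "c + e *\<^sub>R 1 \<in> I" "e > 0"
    and sup: "sup_above I c d"
  shows "pA1 TYPE('a) * (d - c) = d - c"
proof (rule hereditary_central_imp_pA1[OF AW])
  have d: "d \<in> I" "op_le c d" using sup by (auto simp: sup_above_def)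
  then show "positive_el (d - c)" by (simp add: op_le_def)
  fix y assume y: "positive_el y" "op_le y (d - c)"
  show "is_central y"
  proof (rule sup_imp_central[OF AW y(1)])
    fix z :: 'a assume z: "positive_el z"
    define N where "N = max (norm y) (norm z) + 1"
    have "N > 0" unfolding N_def by (smt (verit) norm_ge_zero)
    \<comment> \<open>The bound \<open>t \<le> 1\<close> keeps \<open>c + t y\<close> below
      \<open>d\<close>, as \<open>sup_above\<close> requires; the other one brings
      \<open>t y\<close> and \<open>t z\<close> below \<open>e/4\<close>.\<close>
    define t where "t = min 1 ((e/4) / N)"
    have t: "0 < t" "t \<le> 1" using I(4) \<open>N > 0\<close> by (auto simp: t_def)
    have small: "op_le (t *\<^sub>R v) ((e/4) *\<^sub>R 1)" if "positive_el v" "norm v \<le> N" for v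
    proof -
      have "t * norm v \<le> ((e/4) / N) * N" using I(4) \<open>N > 0\<close> that by (intro mult_mono) (auto simp: t_def)
      then show ?thesis using \<open>N > 0\<close> t positive_adj[OF that(1)] by (intro op_le_norm) auto
    qed
    have quarter: "op_le ((e/4) *\<^sub>R 1) (e *\<^sub>R (1::'a))" using op_le_shift_mono[of "e/4" e 0] I(4) by simp
    have ty: "positive_el (t *\<^sub>R y)" "op_le (t *\<^sub>R y) ((e/4) *\<^sub>R 1)"
      and tz: "positive_el (t *\<^sub>R z)" "op_le (t *\<^sub>R z) ((e/4) *\<^sub>R 1)"
      using y(1) z t by (auto simp: N_def intro!: small positive_scaleR)
    have mem: "c + v \<in> I" if "positive_el v" "op_le v ((e/4) *\<^sub>R 1)" for v
      using that(1) op_le_trans[OF that(2) quarter]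
      by (intro admissible_convex[OF I(1-3)]) (simp_all add: op_le_def)
    have "op_le (t *\<^sub>R y) y"
      using positive_scaleR[OF y(1), of "1 - t"] t by (simp add: op_le_def algebra_simps)
    from op_le_trans[OF this y(2)] have "op_le (c + t *\<^sub>R y) d"
      by (simp add: op_le_def algebra_simps)
    then obtain s where "is_sup_on I (c + t *\<^sub>R y) (c + t *\<^sub>R z) s"
      using sup mem[OF ty] mem[OF tz] ty tz unfolding sup_above_def op_le_def by fastforce
    from is_sup_on_imp_sup_sa[OF I ty(1) tz(1) ty(2) tz(2) this]
    show "\<exists>s. is_sup_on sa_part y z s" using is_sup_on_sa_scaleR t(1) by blast
  qed
qed

text \<open>A substitute for a spectral projection of \<open>h\<close> in the commutative summand:
  with \<open>m = |h|\<close>, \<open>r\<close> comes from the annihilator of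
  \<open>p (m - h)\<close>, so \<open>h = m\<close> on \<open>r\<close>. Since
  \<open>p (m - h) (m + h) = 0\<close>, \<open>h = - m\<close> on the rest of
  \<open>p\<close>.\<close>

lemma commutative_comparison:
  fixes h :: "'a::cstar_algebra"
  assumes AW: "AW_algebra TYPE('a)" and h: "adj h = h"
  defines "p \<equiv> pA1 TYPE('a)"
  obtains r where "central_projection r" "p * r = r" "op_le 0 (r * h)" "op_le (p * (1 - r) * h) 0"
proof -
  have cp: "central_projection p" unfolding p_def by (rule pA1_properties[OF AW])
  have pcomm: "p * (x * y) = p * (y * x)" for x y
  proof -
    have "(x * y - y * x) * p = 0"
      using pA1_properties(2)[OF AW, of p] central_projection_idem[OF cp] unfolding p_def by blast
    then have "p * (x * y - y * x) = 0" using central_projection_commute[OF cp] by simp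
    then show ?thesis by (simp add: right_diff_distrib)
  qed
  obtain m where m: "positive_el m" "m * m = h * h" by (rule positive_sqrt[OF positive_square[OF h]])
  have "\<exists>p'. is_projection p' \<and> {a. \<forall>b\<in>{p * (m - h)}. b * a = 0} = left_mult_set p' UNIV"
    using AW[unfolded AW_algebra_def, THEN spec, THEN mp] by blast
  then obtain g where g: "is_projection g" "{a. p * (m - h) * a = 0} = left_mult_set g UNIV"
    by auto
  have gg: "g * g = g" "adj g = g" using g(1) by (auto simp: is_projection_def)
  define r where "r = p * g"
  have rg: "r * x = p * (g * x)" for x by (simp add: r_def mult.assoc)
  \<comment> \<open>Below \<open>p\<close> all products commute, which makes \<open>r\<close>
    central although nothing of the kind is known about \<open>g\<close>.\<close>
  have "r * x = x * r" for x
  proof -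
    have "r * x = p * (x * g)" by (simp only: rg pcomm)
    also have "\<dots> = x * r" unfolding r_def by (metis central_projection_commute[OF cp] mult.assoc)
    finally show ?thesis .
  qed
  then have "is_central r" by (simp only: is_central_def) blast
  moreover have "r * r = r"
    unfolding r_def by (metis central_projection_commute[OF cp] central_projection_idem[OF cp] gg(1) mult.assoc)
  moreover have "adj r = r"
    unfolding r_def by (simp only: adj_mult gg central_projection_adj[OF cp] central_projection_commute[OF cp])
  ultimately have cr: "central_projection r" by (simp only: central_projection_def is_projection_def simp_thms)
  have "g \<in> left_mult_set g UNIV" unfolding left_mult_set_def by (metis gg(1) rangeI)
  then have "p * (m - h) * g = 0" using g(2) by blast
  then have "r * (m - h) = 0" by (simp only: rg mult.assoc pcomm[of g])
  then have rh: "r * h = r * m" by (simp add: right_diff_distrib)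
  have "p * ((m - h) * (m + h)) = 0"
  proof -
    have "(m - h) * (m + h) = m * h - h * m" by (simp add: algebra_simps m(2))
    then show ?thesis by (simp add: right_diff_distrib pcomm[of m h])
  qed
  then have "m + h \<in> left_mult_set g UNIV" unfolding g(2)[symmetric] by (simp add: mult.assoc)
  then obtain x where "m + h = g * x" by (auto simp: left_mult_set_def)
  then have "g * (m + h) = m + h" using gg(1) by (simp flip: mult.assoc)
  then have "r * (m + h) = p * (m + h)" by (simp only: rg)
  then have "p * ((1 - r) * (m + h)) = 0"
    by (simp add: left_diff_distrib right_diff_distrib r_def central_projection_idem_left[OF cp] mult.assoc)
  then have ph: "p * (1 - r) * h = - (p * (1 - r) * m)"
    by (simp add: distrib_left mult.assoc add.commute eq_neg_iff_add_eq_0)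
  have "positive_el (r * m)" by (rule positive_central_mult[OF cr m(1)])
  moreover have "positive_el (p * ((1 - r) * m))"
    by (intro positive_central_mult cp central_projection_perp cr m(1))
  ultimately show thesis
    using that[OF cr] rh ph by (simp add: op_le_def r_def central_projection_idem_left[OF cp] mult.assoc)
qed

section \<open>Central components expressed by the order\<close>

context
  fixes I :: "'a::cstar_algebra set" and p :: 'a
  assumes AW: "AW_algebra TYPE('a)" and I: "admissible I"
  defines "p \<equiv> pA1 TYPE('a)"
begin

lemma central_p: "central_projection p"
  unfolding p_def by (rule pA1_properties(1)[OF AW])

text \<open>Between \<open>c\<close> and \<open>d\<close> only the \<open>p\<close> component moves.
  In it \<open>d'\<close> and \<open>e\<close> are compared by a central \<open>r\<close>; outside
  \<open>p\<close>, \<open>d'\<close> equals \<open>c\<close> and lies below \<open>e\<close>. So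
  the supremum is \<open>d'\<close> on \<open>r\<close> and \<open>e\<close> on
  \<open>1 - r\<close>.\<close>

lemma pA1_imp_sup_above:
  assumes "c \<in> I" "d \<in> I" "op_le c d" "(1 - p) * c = (1 - p) * d"
  shows "sup_above I c d"
  unfolding sup_above_def
proof (intro conjI ballI impI)
  fix d' e assume d': "d' \<in> I" "op_le c d'" "op_le d' d" and e: "e \<in> I" "op_le c e"
  note cp' = central_projection_perp[OF central_p]
  have pd': "(1 - p) * d' = (1 - p) * c"
    using op_le_central_mult[OF cp' d'(2)] op_le_central_mult[OF cp' d'(3)] assms(4) op_le_antisym by metis
  have "adj (d' - e) = d' - e" using d'(1) e(1) admissible_adj[OF I] by simp
  then obtain r where r: "central_projection r" "p * r = r" "op_le 0 (r * (d' - e))" "op_le (p * (1 - r) * (d' - e)) 0"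
    using commutative_comparison[OF AW] unfolding p_def by metis
  note r' = central_projection_perp[OF r(1)]
  define s where "s = r * d' + (1 - r) * e"
  have rs: "r * s = r * d'" "(1 - r) * s = (1 - r) * e"
    using r(1) by (simp_all add: s_def distrib_left central_projection_simps)
  have re: "op_le (r * e) (r * d')" using r(3) by (simp add: op_le_def right_diff_distrib)
  have red: "op_le ((1 - r) * d') ((1 - r) * e)"
  proof (rule op_le_split[of p])
    show "op_le (p * ((1 - r) * d')) (p * ((1 - r) * e))"
      using r(4) by (simp add: op_le_def right_diff_distrib[of "p * (1 - r)"] flip: mult.assoc)
    have "(1 - p) * ((1 - r) * v) = (1 - r) * ((1 - p) * v)" for v
      by (metis central_projection_commute[OF r'] mult.assoc)
    then show "op_le ((1 - p) * ((1 - r) * d')) ((1 - p) * ((1 - r) * e))"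
      using op_le_central_mult[OF r' op_le_central_mult[OF cp' e(2)]] pd' by simp
  qed
  have "is_sup_on I d' e s"
    unfolding is_sup_on_def
  proof (intro conjI ballI impI)
    show "s \<in> I" unfolding s_def using d'(1) e(1) r(1) by (intro admissible_mix[OF I])
    show "op_le d' s" "op_le e s" by (rule op_le_split[of r]; simp add: rs re red)+
    show "op_le s u" if "op_le d' u" "op_le e u" for u
      unfolding s_def by (rule op_le_mix_upper[OF r(1) that])
  qed
  then show "\<exists>s. is_sup_on I d' e s" ..
qed (use assms in auto)

text \<open>If \<open>a\<close> and \<open>b\<close> differ only in \<open>p\<close>, then
  \<open>d = p b + (1 - p) c\<close> climbs from \<open>c\<close> in the \<open>p\<close> component
  only and has supremum \<open>b\<close> with \<open>a\<close>. Conversely \<open>d - c\<close> lies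
  in \<open>p \<A>\<close>, so \<open>p b + (1 - p) a\<close> bounds \<open>a\<close> and
  \<open>d\<close>, hence \<open>b\<close>.\<close>

lemma commutative_le_iff:
  assumes ab: "a \<in> I" "b \<in> I" "op_le a b"
  shows "commutative_le I a b \<longleftrightarrow> (1 - p) * a = (1 - p) * b"
proof
  note cp' = central_projection_perp[OF central_p]
  assume eq: "(1 - p) * a = (1 - p) * b"
  show "commutative_le I a b"
    unfolding commutative_le_def
  proof (intro conjI ballI impI ab)
    fix c assume c: "c \<in> I" "op_le c a"
    define d where "d = p * b + (1 - p) * c"
    have cb: "op_le c b" using c ab op_le_trans by blast
    have pd: "p * d = p * b" "(1 - p) * d = (1 - p) * c"
      using central_p by (simp_all add: d_def distrib_left central_projection_simps)
    have "d \<in> I" unfolding d_def using ab c central_p by (intro admissible_mix[OF I])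
    have "op_le c d" unfolding d_def using central_p cb by (intro op_le_mix_lower) simp_all
    have "is_sup_on I a d b"
      unfolding is_sup_on_def
    proof (intro conjI ballI impI ab)
      show "op_le d b" unfolding d_def using central_p cb by (intro op_le_mix_upper) simp_all
      show "op_le b u" if "op_le a u" "op_le d u" for u
        using op_le_central_mult[OF central_p that(2)] op_le_central_mult[OF cp' that(1)]
        by (simp add: op_le_split[of p] pd eq)
    qed
    then show "\<exists>d. sup_above I c d \<and> is_sup_on I a d b"
      using pA1_imp_sup_above[OF c(1) \<open>d \<in> I\<close> \<open>op_le c d\<close>] pd by auto
  qed
next
  note cp' = central_projection_perp[OF central_p]
  assume T: "commutative_le I a b"
  \<comment> \<open>The element \<open>a\<close> may be a boundary point, so the argument starts at
    some \<open>c\<close> below it with the room that \<open>sup_above_imp_pA1\<close> asks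
    for.\<close>
  obtain c e where c: "c \<in> I" "e > 0" "op_le c a" "c + e *\<^sub>R 1 \<in> I"
    using admissible_room[OF I ab(1,1)] by metis
  then obtain d where d: "sup_above I c d" "is_sup_on I a d b" using T by (auto simp: commutative_le_def)
  have "p * (d - c) = d - c" unfolding p_def using sup_above_imp_pA1[OF AW I c(1,4,2) d(1)] .
  then have dc: "(1 - p) * d = (1 - p) * c" by (simp add: algebra_simps)
  have db: "op_le d b" using d(2) by (simp add: is_sup_on_def)
  define u where "u = p * b + (1 - p) * a"
  have pu: "p * u = p * b" "(1 - p) * u = (1 - p) * a"
    using central_p by (simp_all add: u_def distrib_left central_projection_simps)
  have "u \<in> I" unfolding u_def using ab central_p by (intro admissible_mix[OF I])
  moreover have "op_le a u" unfolding u_def using central_p ab by (intro op_le_mix_lower) simp_all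
  moreover have "op_le d u"
    by (rule op_le_split[of p])
      (simp_all add: pu dc op_le_central_mult[OF central_p db] op_le_central_mult[OF cp' c(3)])
  ultimately have "op_le b u" using d(2) by (simp add: is_sup_on_def)
  then have "op_le ((1 - p) * b) ((1 - p) * a)" using op_le_central_mult[OF cp'] pu by metis
  then show "(1 - p) * a = (1 - p) * b" using op_le_central_mult[OF cp' ab(3)] op_le_antisym by blast
qed

lemma noncommutative_le_iff:
  assumes ab: "a \<in> I" "b \<in> I" "op_le a b"
  shows "noncommutative_le I a b \<longleftrightarrow> p * a = p * b"
proof
  assume S: "noncommutative_le I a b"
  \<comment> \<open>A step from \<open>a\<close> in the \<open>p\<close> component alone; it is
    commutative, so it must be trivial.\<close>
  define c where "c = p * b + (1 - p) * a"
  have pc: "p * c = p * b" "(1 - p) * c = (1 - p) * a"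
    using central_p by (simp_all add: c_def distrib_left central_projection_simps)
  have "c \<in> I" unfolding c_def using ab central_p by (intro admissible_mix[OF I])
  moreover have "op_le a c" unfolding c_def using central_p ab by (intro op_le_mix_lower) simp_all
  moreover have "op_le c b" unfolding c_def using central_p ab by (intro op_le_mix_upper) simp_all
  ultimately have "c = a" using S commutative_le_iff[OF ab(1), of c] pc unfolding noncommutative_le_def by simp
  then show "p * a = p * b" using pc by simp
next
  assume eq: "p * a = p * b"
  have "c = a" if "c \<in> I" "op_le a c" "op_le c b" "commutative_le I a c" for c
  proof -
    have "(1 - p) * a = (1 - p) * c" using commutative_le_iff[OF ab(1)] that by blast
    moreover have "p * a = p * c"
      using op_le_central_mult[OF central_p that(2)] op_le_central_mult[OF central_p that(3)] eq op_le_antisym by metis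
    ultimately show ?thesis using eq_split by metis
  qed
  then show "noncommutative_le I a b" using ab by (auto simp: noncommutative_le_def)
qed

text \<open>Reduces arbitrary pairs to comparable ones: \<open>e\<close> takes its \<open>p\<close>
  component from a common lower bound \<open>c\<close> and shares the other component with
  \<open>a\<close> and \<open>b\<close>.\<close>

lemma pA1_perp_eq_iff:
  assumes ab: "a \<in> I" "b \<in> I"
  shows "(1 - p) * a = (1 - p) * b \<longleftrightarrow> (\<exists>e\<in>I. commutative_le I e a \<and> commutative_le I e b)"
proof
  assume eq: "(1 - p) * a = (1 - p) * b"
  obtain c where c: "c \<in> I" "op_le c a" "op_le c b" using admissible_room[OF I ab] by metis
  define e where "e = p * c + (1 - p) * a"
  have e': "e = p * c + (1 - p) * b" unfolding e_def eq ..
  have "e \<in> I" unfolding e_def using ab c central_p by (intro admissible_mix[OF I])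
  moreover have "op_le e a" unfolding e_def using central_p c by (intro op_le_mix_upper) simp_all
  moreover have "op_le e b" unfolding e' using central_p c by (intro op_le_mix_upper) simp_all
  moreover have "(1 - p) * e = (1 - p) * a"
    using central_p by (simp add: e_def distrib_left central_projection_simps)
  ultimately show "\<exists>e\<in>I. commutative_le I e a \<and> commutative_le I e b"
    using commutative_le_iff ab eq by (intro bexI[of _ e]) auto
next
  assume "\<exists>e\<in>I. commutative_le I e a \<and> commutative_le I e b"
  then show "(1 - p) * a = (1 - p) * b" using commutative_le_iff ab by (metis commutative_le_def)
qed

text \<open>As for \<open>pA1_perp_eq_iff\<close>, with the roles of \<open>p\<close> and
  \<open>1 - p\<close> exchanged.\<close>

lemma pA1_eq_iff:
  assumes ab: "a \<in> I" "b \<in> I"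
  shows "p * a = p * b \<longleftrightarrow> (\<exists>e\<in>I. noncommutative_le I e a \<and> noncommutative_le I e b)"
proof
  assume eq: "p * a = p * b"
  obtain c where c: "c \<in> I" "op_le c a" "op_le c b" using admissible_room[OF I ab] by metis
  define e where "e = p * a + (1 - p) * c"
  have e': "e = p * b + (1 - p) * c" unfolding e_def eq ..
  have "e \<in> I" unfolding e_def using ab c central_p by (intro admissible_mix[OF I])
  moreover have "op_le e a" unfolding e_def using central_p c by (intro op_le_mix_upper) simp_all
  moreover have "op_le e b" unfolding e' using central_p c by (intro op_le_mix_upper) simp_all
  moreover have "p * e = p * a"
    using central_p by (simp add: e_def distrib_left central_projection_simps)
  ultimately show "\<exists>e\<in>I. noncommutative_le I e a \<and> noncommutative_le I e b"
    using noncommutative_le_iff ab eq by (intro bexI[of _ e]) auto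
next
  assume "\<exists>e\<in>I. noncommutative_le I e a \<and> noncommutative_le I e b"
  then show "p * a = p * b" using noncommutative_le_iff ab by (metis noncommutative_le_def)
qed

end

section \<open>Order isomorphisms\<close>

lemma order_iso_on_le: "order_iso_on f I J \<Longrightarrow> a \<in> I \<Longrightarrow> b \<in> I \<Longrightarrow> op_le (f a) (f b) \<longleftrightarrow> op_le a b"
  by (auto simp: order_iso_on_def)

lemma order_iso_on_image: "order_iso_on f I J \<Longrightarrow> f ` I = J"
  by (simp add: order_iso_on_def bij_betw_def)

lemma order_iso_on_mem: "order_iso_on f I J \<Longrightarrow> a \<in> I \<Longrightarrow> f a \<in> J"
  using order_iso_on_image by blast

lemma order_iso_on_inv:
  assumes "order_iso_on f I J"
  shows "order_iso_on (inv_into I f) J I" "a \<in> I \<Longrightarrow> inv_into I f (f a) = a"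
proof -
  have bij: "bij_betw f I J" using assms by (simp add: order_iso_on_def)
  then show "a \<in> I \<Longrightarrow> inv_into I f (f a) = a" by (simp add: bij_betw_def)
  have "op_le x y \<longleftrightarrow> op_le (inv_into I f x) (inv_into I f y)" if "x \<in> J" "y \<in> J" for x y
    using order_iso_on_le[OF assms, of "inv_into I f x" "inv_into I f y"] that bij
    by (simp add: bij_betw_def f_inv_into_f inv_into_into)
  then show "order_iso_on (inv_into I f) J I"
    using bij_betw_inv_into[OF bij] by (simp add: order_iso_on_def)
qed

lemma order_iso_on_is_sup_on:
  assumes f: "order_iso_on f I J" and "a \<in> I" "b \<in> I" "is_sup_on I a b s"
  shows "is_sup_on J (f a) (f b) (f s)"
  using assms(2-) unfolding is_sup_on_def order_iso_on_image[OF f, symmetric]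
  by (auto simp: order_iso_on_le[OF f])

lemma order_iso_on_sup_above:
  assumes f: "order_iso_on f I J" and c: "c \<in> I" and sup: "sup_above I c d"
  shows "sup_above J (f c) (f d)"
  unfolding sup_above_def
proof (intro conjI ballI impI)
  have d: "d \<in> I" "op_le c d" using sup by (auto simp: sup_above_def)
  then show "f d \<in> J" "op_le (f c) (f d)" using c by (simp_all add: order_iso_on_mem[OF f] order_iso_on_le[OF f])
  fix d' e assume "d' \<in> J" "op_le (f c) d'" "op_le d' (f d)" "e \<in> J" "op_le (f c) e"
  then obtain d1 e1 where 1: "d1 \<in> I" "e1 \<in> I" "d' = f d1" "e = f e1" "op_le c d1" "op_le d1 d" "op_le c e1"
    using c d order_iso_on_image[OF f] order_iso_on_le[OF f] by (metis imageE)
  then obtain s where "is_sup_on I d1 e1 s" using sup unfolding sup_above_def by blast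
  then show "\<exists>s. is_sup_on J d' e s" using order_iso_on_is_sup_on[OF f] 1 by blast
qed

lemma order_iso_on_commutative_le_imp:
  assumes f: "order_iso_on f I J" and ab: "a \<in> I" and T: "commutative_le I a b" and b: "b \<in> I"
  shows "commutative_le J (f a) (f b)"
  unfolding commutative_le_def
proof (intro conjI ballI impI)
  show "op_le (f a) (f b)" using T ab b by (simp add: order_iso_on_le[OF f] commutative_le_def)
  fix c assume "c \<in> J" "op_le c (f a)"
  then obtain c1 where c1: "c1 \<in> I" "c = f c1" "op_le c1 a"
    using ab order_iso_on_image[OF f] order_iso_on_le[OF f] by (metis imageE)
  then obtain d where d: "sup_above I c1 d" "is_sup_on I a d b" using T unfolding commutative_le_def by blast
  then have "d \<in> I" by (simp add: sup_above_def)
  then show "\<exists>d. sup_above J c d \<and> is_sup_on J (f a) d (f b)"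
    using order_iso_on_sup_above[OF f c1(1) d(1)] order_iso_on_is_sup_on[OF f ab _ d(2)] c1(2) by blast
qed

text \<open>Both directions are needed, because \<open>commutative_le\<close> occurs as a premise
  inside \<open>noncommutative_le\<close>; the inverse isomorphism gives the second one.\<close>

lemma order_iso_on_commutative_le:
  assumes f: "order_iso_on f I J" and ab: "a \<in> I" "b \<in> I"
  shows "commutative_le J (f a) (f b) \<longleftrightarrow> commutative_le I a b"
proof
  assume "commutative_le J (f a) (f b)"
  from order_iso_on_commutative_le_imp[OF order_iso_on_inv(1)[OF f] _ this] ab
  show "commutative_le I a b" by (simp add: order_iso_on_inv(2)[OF f] order_iso_on_mem[OF f])
qed (rule order_iso_on_commutative_le_imp[OF f ab(1) _ ab(2)])

lemma order_iso_on_noncommutative_le: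
  assumes f: "order_iso_on f I J" and ab: "a \<in> I" "b \<in> I" and S: "noncommutative_le I a b"
  shows "noncommutative_le J (f a) (f b)"
  unfolding noncommutative_le_def
proof (intro conjI ballI impI)
  show "op_le (f a) (f b)" using S ab by (simp add: order_iso_on_le[OF f] noncommutative_le_def)
  fix c assume c: "c \<in> J" "op_le (f a) c" "op_le c (f b)" "commutative_le J (f a) c"
  then obtain c1 where c1: "c1 \<in> I" "c = f c1" using order_iso_on_image[OF f] by blast
  then have "c1 = a"
    using S c ab unfolding noncommutative_le_def
    by (simp add: order_iso_on_le[OF f] order_iso_on_commutative_le[OF f])
  then show "c = f a" using c1 by simp
qed

text \<open>Equality of components is preserved by its order description. An inequality in one
  component becomes a full inequality \<open>c \<le> b\<close> once the other component of
  \<open>a\<close> is replaced by that of \<open>b\<close>; \<open>f\<close> preserves it, and the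
  replacement does not affect the component in question.\<close>

lemma order_iso_on_pA1_le:
  fixes f :: "'a::cstar_algebra \<Rightarrow> 'b::cstar_algebra"
  assumes AW: "AW_algebra TYPE('a)" "AW_algebra TYPE('b)" and adm: "admissible I" "admissible J"
    and f: "order_iso_on f I J" and ab: "a \<in> I" "b \<in> I"
  defines "p \<equiv> pA1 TYPE('a)" and "q \<equiv> pA1 TYPE('b)"
  shows "op_le (p * a) (p * b) \<Longrightarrow> op_le (q * f a) (q * f b)"
    and "op_le ((1 - p) * a) ((1 - p) * b) \<Longrightarrow> op_le ((1 - q) * f a) ((1 - q) * f b)"
proof -
  have cp: "central_projection p" and cq: "central_projection q"
    unfolding p_def q_def by (rule pA1_properties(1)[OF AW(1)], rule pA1_properties(1)[OF AW(2)])
  note cp' = central_projection_perp[OF cp] and cq' = central_projection_perp[OF cq]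
  have eq: "q * f x = q * f y" if xy: "x \<in> I" "y \<in> I" "p * x = p * y" for x y
  proof -
    obtain e where e: "e \<in> I" "noncommutative_le I e x" "noncommutative_le I e y"
      using pA1_eq_iff[OF AW(1) adm(1) xy(1,2)] xy(3) unfolding p_def by blast
    then have "noncommutative_le J (f e) (f x)" "noncommutative_le J (f e) (f y)"
      using order_iso_on_noncommutative_le[OF f] that by blast+
    then show ?thesis
      using pA1_eq_iff[OF AW(2) adm(2)] order_iso_on_mem[OF f] that e(1) unfolding q_def by blast
  qed
  have eq': "(1 - q) * f x = (1 - q) * f y" if xy: "x \<in> I" "y \<in> I" "(1 - p) * x = (1 - p) * y" for x y
  proof -
    obtain e where e: "e \<in> I" "commutative_le I e x" "commutative_le I e y"
      using pA1_perp_eq_iff[OF AW(1) adm(1) xy(1,2)] xy(3) unfolding p_def by blast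
    then have "commutative_le J (f e) (f x)" "commutative_le J (f e) (f y)"
      using order_iso_on_commutative_le[OF f] that by blast+
    then show ?thesis
      using pA1_perp_eq_iff[OF AW(2) adm(2)] order_iso_on_mem[OF f] that e(1) unfolding q_def by blast
  qed
  show "op_le (q * f a) (q * f b)" if le: "op_le (p * a) (p * b)"
  proof -
    define c where "c = p * a + (1 - p) * b"
    have pc: "p * c = p * a" "(1 - p) * c = (1 - p) * b"
      using cp by (simp_all add: c_def distrib_left central_projection_simps)
    have "c \<in> I" unfolding c_def using ab cp by (intro admissible_mix[OF adm(1)])
    moreover have "op_le c b" by (rule op_le_split[of p]) (simp_all add: pc le)
    ultimately have "op_le (q * f c) (q * f b)"
      using ab by (intro op_le_central_mult[OF cq]) (simp add: order_iso_on_le[OF f])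
    then show ?thesis using eq[OF \<open>c \<in> I\<close> ab(1) pc(1)] by simp
  qed
  show "op_le ((1 - q) * f a) ((1 - q) * f b)" if le: "op_le ((1 - p) * a) ((1 - p) * b)"
  proof -
    define c where "c = p * b + (1 - p) * a"
    have pc: "p * c = p * b" "(1 - p) * c = (1 - p) * a"
      using cp by (simp_all add: c_def distrib_left central_projection_simps)
    have "c \<in> I" unfolding c_def using ab cp by (intro admissible_mix[OF adm(1)])
    moreover have "op_le c b" by (rule op_le_split[of p]) (simp_all add: pc le)
    ultimately have "op_le ((1 - q) * f c) ((1 - q) * f b)"
      using ab by (intro op_le_central_mult[OF cq']) (simp add: order_iso_on_le[OF f])
    then show ?thesis using eq'[OF \<open>c \<in> I\<close> ab(1) pc(2)] by simp
  qed
qed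

text \<open>When \<open>f\<close> and \<open>g\<close> induce the same preorder on \<open>I\<close>,
  antisymmetry of \<open>op_le\<close> makes the induced map between their images well defined and
  injective.\<close>

lemma order_iso_on_factor:
  assumes "\<And>a b. a \<in> I \<Longrightarrow> b \<in> I \<Longrightarrow> op_le (f a) (f b) \<longleftrightarrow> op_le (g a) (g b)"
  obtains h where "order_iso_on h (f ` I) (g ` I)" "\<And>a. a \<in> I \<Longrightarrow> h (f a) = g a"
proof -
  define h where "h x = g (inv_into I f x)" for x
  have h: "h (f a) = g a" if "a \<in> I" for a
  proof -
    have b: "inv_into I f (f a) \<in> I" "f (inv_into I f (f a)) = f a"
      using that by (auto intro: inv_into_into f_inv_into_f)
    then have "op_le (g (inv_into I f (f a))) (g a)" "op_le (g a) (g (inv_into I f (f a)))"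
      using assms[OF b(1) that] assms[OF that b(1)] by simp_all
    then show ?thesis unfolding h_def by (rule op_le_antisym)
  qed
  have "inj_on h (f ` I)"
  proof (rule inj_onI)
    fix x y assume "x \<in> f ` I" "y \<in> f ` I" "h x = h y"
    then obtain a b where ab: "a \<in> I" "b \<in> I" "x = f a" "y = f b" "g a = g b" using h by auto
    then have "op_le (f a) (f b)" "op_le (f b) (f a)" using assms by simp_all
    then show "x = y" using ab op_le_antisym by blast
  qed
  moreover have "h ` f ` I = g ` I" using h by (force simp: image_image)
  ultimately have "order_iso_on h (f ` I) (g ` I)"
    using assms by (auto simp: order_iso_on_def bij_betw_def h)
  then show thesis using that h by blast
qed

section \<open>Splitting an order isomorphism into its two central components\<close>

theorem theorem3p4:
  fixes \<Phi> :: "'a::cstar_algebra \<Rightarrow> 'b::cstar_algebra"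
    and I :: "'a set" and J :: "'b set"
  assumes "AW_algebra TYPE('a)" and "AW_algebra TYPE('b)"
    and "operator_interval I" and "operator_interval J"
    and "order_iso_on \<Phi> I J"
  defines "p \<equiv> pA1 TYPE('a)" and "q \<equiv> pA1 TYPE('b)"
  shows "(\<exists>\<Phi>1 \<Phi>m.
            order_iso_on \<Phi>1 (left_mult_set p I) (left_mult_set q J)
          \<and> order_iso_on \<Phi>m (left_mult_set (perp p) I) (left_mult_set (perp q) J)
          \<and> (\<forall>a\<in>I. \<Phi> a = \<Phi>1 (p * a) + \<Phi>m (perp p * a)))
       \<and> (\<forall>\<Phi>1 \<Phi>m \<Psi>1 \<Psi>m.
            order_iso_on \<Phi>1 (left_mult_set p I) (left_mult_set q J)
          \<and> order_iso_on \<Phi>m (left_mult_set (perp p) I) (left_mult_set (perp q) J)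
          \<and> (\<forall>a\<in>I. \<Phi> a = \<Phi>1 (p * a) + \<Phi>m (perp p * a))
          \<and> order_iso_on \<Psi>1 (left_mult_set p I) (left_mult_set q J)
          \<and> order_iso_on \<Psi>m (left_mult_set (perp p) I) (left_mult_set (perp q) J)
          \<and> (\<forall>a\<in>I. \<Phi> a = \<Psi>1 (p * a) + \<Psi>m (perp p * a))
          \<longrightarrow> (\<forall>x\<in>left_mult_set p I. \<Phi>1 x = \<Psi>1 x)
            \<and> (\<forall>x\<in>left_mult_set (perp p) I. \<Phi>m x = \<Psi>m x))"
proof (intro conjI allI impI)
  have adm: "admissible I" "admissible J" using assms(3,4) operator_interval_admissible by blast+
  note iso = assms(5)
  have inv: "order_iso_on (inv_into I \<Phi>) J I" "\<And>a. a \<in> I \<Longrightarrow> inv_into I \<Phi> (\<Phi> a) = a"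
    using order_iso_on_inv[OF iso] by blast+
  note fwd = order_iso_on_pA1_le[OF assms(1,2) adm iso, folded p_def q_def]
  note bwd = order_iso_on_pA1_le[OF assms(2,1) adm(2,1) inv(1), folded p_def q_def]
  \<comment> \<open>One direction is \<open>fwd\<close>; the other is \<open>bwd\<close>, which
    concerns the inverse isomorphism.\<close>
  have le_iff: "op_le (p * a) (p * b) \<longleftrightarrow> op_le (q * \<Phi> a) (q * \<Phi> b)"
    and le_iff': "op_le (perp p * a) (perp p * b) \<longleftrightarrow> op_le (perp q * \<Phi> a) (perp q * \<Phi> b)"
    if "a \<in> I" "b \<in> I" for a b
    using fwd[OF that] bwd[of "\<Phi> a" "\<Phi> b"] that order_iso_on_mem[OF iso]
    by (auto simp: inv(2) perp_def)
  obtain \<Phi>1 where \<Phi>1: "order_iso_on \<Phi>1 ((\<lambda>a. p * a) ` I) ((\<lambda>a. q * \<Phi> a) ` I)" "\<And>a. a \<in> I \<Longrightarrow> \<Phi>1 (p * a) = q * \<Phi> a"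
    using order_iso_on_factor[of I "\<lambda>a. p * a" "\<lambda>a. q * \<Phi> a", OF le_iff] by blast
  obtain \<Phi>m where \<Phi>m: "order_iso_on \<Phi>m ((\<lambda>a. perp p * a) ` I) ((\<lambda>a. perp q * \<Phi> a) ` I)"
      "\<And>a. a \<in> I \<Longrightarrow> \<Phi>m (perp p * a) = perp q * \<Phi> a"
    using order_iso_on_factor[of I "\<lambda>a. perp p * a" "\<lambda>a. perp q * \<Phi> a", OF le_iff'] by blast
  have J: "left_mult_set r J = (\<lambda>a. r * \<Phi> a) ` I" for r
    unfolding left_mult_set_def order_iso_on_image[OF iso, symmetric] image_image ..
  have "\<Phi> a = \<Phi>1 (p * a) + \<Phi>m (perp p * a)" if "a \<in> I" for a
    unfolding \<Phi>1(2)[OF that] \<Phi>m(2)[OF that] by (simp add: perp_def flip: distrib_right)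
  then show "\<exists>\<Phi>1 \<Phi>m.
            order_iso_on \<Phi>1 (left_mult_set p I) (left_mult_set q J)
          \<and> order_iso_on \<Phi>m (left_mult_set (perp p) I) (left_mult_set (perp q) J)
          \<and> (\<forall>a\<in>I. \<Phi> a = \<Phi>1 (p * a) + \<Phi>m (perp p * a))"
    using \<Phi>1(1) \<Phi>m(1) unfolding J unfolding left_mult_set_def by blast
next
  fix \<Phi>1 \<Phi>m \<Psi>1 \<Psi>m
  assume H: "order_iso_on \<Phi>1 (left_mult_set p I) (left_mult_set q J)
          \<and> order_iso_on \<Phi>m (left_mult_set (perp p) I) (left_mult_set (perp q) J)
          \<and> (\<forall>a\<in>I. \<Phi> a = \<Phi>1 (p * a) + \<Phi>m (perp p * a))
          \<and> order_iso_on \<Psi>1 (left_mult_set p I) (left_mult_set q J)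
          \<and> order_iso_on \<Psi>m (left_mult_set (perp p) I) (left_mult_set (perp q) J)
          \<and> (\<forall>a\<in>I. \<Phi> a = \<Psi>1 (p * a) + \<Psi>m (perp p * a))"
  have cq: "central_projection q" unfolding q_def by (rule pA1_properties(1)[OF assms(2)])
  \<comment> \<open>Multiplying by \<open>q\<close> or \<open>perp q\<close> removes the other
    summand, because \<open>F\<close> has values in \<open>q J\<close> and \<open>G\<close> in
    \<open>perp q J\<close>. So both maps are determined by \<open>\<Phi>\<close>.\<close>
  have components: "q * \<Phi> a = F (p * a)" "perp q * \<Phi> a = G (perp p * a)"
    if F: "order_iso_on F (left_mult_set p I) (left_mult_set q J)"
      and G: "order_iso_on G (left_mult_set (perp p) I) (left_mult_set (perp q) J)"
      and sum: "\<forall>a\<in>I. \<Phi> a = F (p * a) + G (perp p * a)" and a: "a \<in> I" for F G a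
  proof -
    have "F (p * a) \<in> left_mult_set q J" "G (perp p * a) \<in> left_mult_set (perp q) J"
      by (rule order_iso_on_mem[OF F] order_iso_on_mem[OF G], use a in \<open>simp add: left_mult_set_def\<close>)+
    then obtain x y where "F (p * a) = q * x" "G (perp p * a) = (1 - q) * y"
      by (auto simp: left_mult_set_def perp_def)
    then show "q * \<Phi> a = F (p * a)" "perp q * \<Phi> a = G (perp p * a)"
      using sum a by (simp_all add: perp_def distrib_left central_projection_simps cq)
  qed
  show "\<forall>x\<in>left_mult_set p I. \<Phi>1 x = \<Psi>1 x"
    using components[of \<Phi>1 \<Phi>m] components[of \<Psi>1 \<Psi>m] H unfolding left_mult_set_def by auto
  show "\<forall>x\<in>left_mult_set (perp p) I. \<Phi>m x = \<Psi>m x"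
    using components[of \<Phi>1 \<Phi>m] components[of \<Psi>1 \<Psi>m] H unfolding left_mult_set_def by auto
qed

end
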